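(* Let $t \geq 2$ be an integer. Every $K^{\ast}_{2,t}$-minor-free graph $G$ is isomorphic to a subgraph of $H \boxtimes K_{t-1}$ for some graph $H$ with $\mathrm{tw}(H) \leq 2$.
   Context: All graphs are finite, simple and undirected. $\mathrm{tw}$ denotes treewidth. $K^{\ast}_{2,t}$ is the graph obtained from the complete bipartite graph $K_{2,t}$ by adding the edge between the two vertices of the part of size $2$. The strong product $A \boxtimes B$ has vertex-set $V(A)\times V(B)$, where distinct $(v,x),(w,y)$ are adjacent if ($v=w$ and $xy\in E(B)$), or ($x=y$ and $vw\in E(A)$), or ($vw\in E(A)$ and $xy\in E(B)$). $K_{t-1}$ is the complete graph on $t-1$ vertices. *)

theory Defs
  imports "Graph_Theory.Graph_Theory"
begin

text \<open>
  Finite simple undirected graphs are rendered as in the imported library: \<^locale>\<open>pair_graph\<close> is a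
  finite, loop-free, symmetric set of ordered pairs on a finite vertex set, so an undirected edge
  corresponds to the two arcs joining its ends.
\<close>

definition complete_graph :: "nat \<Rightarrow> nat pair_pre_digraph" where
  "complete_graph n = \<lparr> pverts = {..<n}, parcs = {(u, v). u < n \<and> v < n \<and> u \<noteq> v} \<rparr>"

text \<open>The parts of $K_{2,t}$ are \<open>{0, 1}\<close> and \<open>{2..<t + 2}\<close>.\<close>

definition K2_star :: "nat \<Rightarrow> nat pair_pre_digraph" where
  "K2_star t =
    \<lparr> pverts = {0, 1} \<union> {2..<t + 2},
      parcs = {0, 1} \<times> {2..<t + 2} \<union> {2..<t + 2} \<times> {0, 1} \<union> {(0, 1), (1, 0)} \<rparr>"

definition strong_product ::
  "'a pair_pre_digraph \<Rightarrow> 'b pair_pre_digraph \<Rightarrow> ('a \<times> 'b) pair_pre_digraph" where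
  "strong_product A B =
    \<lparr> pverts = pverts A \<times> pverts B,
      parcs = {((v, x), (w, y)).
        {(v, x), (w, y)} \<subseteq> pverts A \<times> pverts B \<and> (v, x) \<noteq> (w, y) \<and>
        (v = w \<and> (x, y) \<in> parcs B \<or>
         x = y \<and> (v, w) \<in> parcs A \<or>
         (v, w) \<in> parcs A \<and> (x, y) \<in> parcs B)} \<rparr>"

definition iso_to_subgraph :: "'a pair_pre_digraph \<Rightarrow> 'b pair_pre_digraph \<Rightarrow> bool" where
  "iso_to_subgraph G J \<longleftrightarrow>
    (\<exists>S. pair_graph S \<and> subgraph (with_proj S) (with_proj J) \<and>
         digraph_iso (with_proj G) (with_proj S))"

text \<open>
  The vertex arising from the contraction of \<open>uv\<close> keeps the name \<open>u\<close>; loops are discarded, and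
  parallel edges are identified because arcs are pairs.
\<close>

definition contract_edge :: "'a \<Rightarrow> 'a \<Rightarrow> 'a pair_pre_digraph \<Rightarrow> 'a pair_pre_digraph" where
  "contract_edge u v G = (let f = (\<lambda>x. if x = v then u else x) in
    \<lparr> pverts = f ` pverts G,
      parcs = {(f x, f y) | x y. (x, y) \<in> parcs G \<and> f x \<noteq> f y} \<rparr>)"

inductive contracts_to :: "'a pair_pre_digraph \<Rightarrow> 'a pair_pre_digraph \<Rightarrow> bool" for G where
  refl: "contracts_to G G"
| step: "contracts_to G M \<Longrightarrow> (u, v) \<in> parcs M \<Longrightarrow> contracts_to G (contract_edge u v M)"

definition is_minor :: "'b pair_pre_digraph \<Rightarrow> 'a pair_pre_digraph \<Rightarrow> bool" where
  "is_minor X G \<longleftrightarrow>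
    (\<exists>S M. pair_graph S \<and> subgraph (with_proj S) (with_proj G) \<and> contracts_to S M \<and>
           digraph_iso (with_proj X) (with_proj M))"

abbreviation minor_free :: "'b pair_pre_digraph \<Rightarrow> 'a pair_pre_digraph \<Rightarrow> bool" where
  "minor_free X G \<equiv> \<not> is_minor X G"

text \<open>
  The library predicate \<^const>\<open>tree\<close> is meant for directed graphs: in a symmetric digraph every edge
  yields a directed cycle of length 2. Undirected cycles are the cycles of length at least 3.
\<close>

definition undirected_tree :: "'a pair_pre_digraph \<Rightarrow> bool" where
  "undirected_tree T \<longleftrightarrow>
    pair_graph T \<and> Digraph_Component.connected (with_proj T) \<and>
    \<not> (\<exists>p. pre_digraph.cycle (with_proj T) p \<and> 3 \<le> length p)"

text \<open>The library notion of connectedness used here includes non-emptiness of the vertex set.\<close>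

definition tree_decomposition ::
  "'a pair_pre_digraph \<Rightarrow> 'i pair_pre_digraph \<Rightarrow> ('i \<Rightarrow> 'a set) \<Rightarrow> bool" where
  "tree_decomposition G T B \<longleftrightarrow>
    undirected_tree T \<and>
    (\<forall>i \<in> pverts T. B i \<subseteq> pverts G) \<and>
    (\<forall>(v, w) \<in> parcs G. \<exists>i \<in> pverts T. v \<in> B i \<and> w \<in> B i) \<and>
    (\<forall>v \<in> pverts G. Digraph_Component.connected (with_proj T \<restriction> {i \<in> pverts T. v \<in> B i}))"

definition decomposition_width :: "'i pair_pre_digraph \<Rightarrow> ('i \<Rightarrow> 'a set) \<Rightarrow> int" where
  "decomposition_width T B = Max ((\<lambda>i. int (card (B i))) ` pverts T) - 1"

text \<open>
  Every finite tree is isomorphic to one with natural numbers as vertices, so nothing is lost by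
  fixing the type of tree nodes. Widths are integers bounded below by \<open>-1\<close>, so the infimum is a
  minimum; the graph without vertices has treewidth \<open>-1\<close>.
\<close>

definition treewidth :: "'a pair_pre_digraph \<Rightarrow> int" where
  "treewidth G =
    Inf {decomposition_width T B | (T :: nat pair_pre_digraph) B. tree_decomposition G T B}"

end

theory Submission
  imports Defs "HOL-Library.Disjoint_Sets"
begin

text \<open>
  The parts of a partition of \<open>V(G)\<close> are chosen one after another so that every component \<open>C\<close> of
  the unassigned vertices has all its outside neighbours in two parts sharing a bag, and these
  neighbours lie in two disjoint, adjacent, connected sets \<open>A\<close> and \<open>B\<close> avoiding \<open>C\<close>. By Menger's
  theorem, \<open>t\<close> disjoint connections inside \<open>C\<close> between the neighbours of \<open>A\<close> and those of \<open>B\<close> would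
  give a $K^{\ast}_{2,t}$ minor, so at most \<open>t - 1\<close> vertices \<open>P\<close> of \<open>C\<close> separate them. An
  inclusion-minimal such \<open>P\<close> is the next part. No component of \<open>C - P\<close> sees both \<open>A\<close> and \<open>B\<close>; if it
  does not see \<open>B\<close>, then \<open>B\<close> may be enlarged by \<open>P\<close> and everything on the side of \<open>B\<close>, and this set is
  connected because \<open>P\<close> is minimal. If \<open>C\<close> sees only one of \<open>A\<close> and \<open>B\<close>, a single vertex of \<open>C\<close>
  adjacent to that set is the next part; if it sees neither, any vertex is.
\<close>

section \<open>Connected sets\<close>

inductive_set reach :: "'a rel \<Rightarrow> 'a set \<Rightarrow> 'a set \<Rightarrow> 'a set"
  for E :: "'a rel" and Z X :: "'a set" where
  base: "x \<in> X \<Longrightarrow> x \<in> Z \<Longrightarrow> x \<in> reach E Z X"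
| step: "u \<in> reach E Z X \<Longrightarrow> (u, v) \<in> E \<Longrightarrow> v \<in> Z \<Longrightarrow> v \<in> reach E Z X"

lemma reach_subset: "reach E Z X \<subseteq> Z"
  by (rule subsetI, erule reach.cases) simp_all

lemma reach_mono: "E \<subseteq> E' \<Longrightarrow> Z \<subseteq> Z' \<Longrightarrow> X \<subseteq> X' \<Longrightarrow> reach E Z X \<subseteq> reach E' Z' X'"
proof
  show "v \<in> reach E' Z' X'" if "v \<in> reach E Z X" "E \<subseteq> E'" "Z \<subseteq> Z'" "X \<subseteq> X'" for v
    using that by induction (blast intro: reach.intros)+
qed

lemma reach_trans:
  assumes "X \<subseteq> reach E Z W" shows "reach E Z X \<subseteq> reach E Z W"
proof
  show "v \<in> reach E Z W" if "v \<in> reach E Z X" for v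
    using that by induction (use assms in \<open>auto intro: reach.step\<close>)
qed

lemma reach_sym:
  assumes "sym E" "v \<in> reach E Z {u}" shows "u \<in> reach E Z {v}"
  using assms(2)
proof induction
  case (step a b)
  have "a \<in> Z" using step.hyps(1) reach_subset by fast
  then have "{a} \<subseteq> reach E Z {b}"
    using step.hyps(2,3) symD[OF assms(1)] by (blast intro: reach.intros)
  then have "reach E Z {a} \<subseteq> reach E Z {b}" by (rule reach_trans)
  then show ?case using step.IH by blast
qed (auto intro: reach.base)

lemma reach_from_single:
  assumes "v \<in> reach E Z X"
  obtains x where "x \<in> X" "v \<in> reach E Z {x}"
proof -
  have "\<exists>x\<in>X. v \<in> reach E Z {x}"
    using assms by induction (blast intro: reach.intros)+
  then show ?thesis using that by blast
qed

lemma reach_within_reach: "reach E Z X \<subseteq> reach E (reach E Z X) X"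
proof
  show "v \<in> reach E (reach E Z X) X" if "v \<in> reach E Z X" for v
    using that by induction (blast intro: reach.intros)+
qed

definition connected_in :: "'a rel \<Rightarrow> 'a set \<Rightarrow> bool" where
  "connected_in E D \<longleftrightarrow> (\<forall>u\<in>D. D \<subseteq> reach E D {u})"

lemma connected_in_empty [simp]: "connected_in E {}"
  by (simp add: connected_in_def)

lemma connected_in_singleton [simp]: "connected_in E {v}"
  by (auto simp: connected_in_def intro: reach.base)

lemma connected_in_mono: "connected_in E D \<Longrightarrow> E \<subseteq> E' \<Longrightarrow> connected_in E' D"
  unfolding connected_in_def by (blast intro: reach_mono[THEN subsetD])

lemma connected_in_Restr:
  assumes "connected_in E D" shows "connected_in (Restr E D) D"
proof -
  have "v \<in> reach (Restr E D) D {u}" if "v \<in> reach E D {u}" for u v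
    using that
  proof induction
    case (step a b)
    have "a \<in> D" using reach_subset step.hyps(1) by (rule subsetD)
    then show ?case using step by (auto intro: reach.step)
  qed (auto intro: reach.base)
  then show ?thesis using assms unfolding connected_in_def by blast
qed

lemma connected_in_neighbour:
  assumes "connected_in E D" "u \<in> D" "v \<in> D" "u \<noteq> v"
  obtains w where "(u, w) \<in> E" "w \<in> D"
proof -
  have "v \<in> reach E D {u}" using assms(1-3) by (auto simp: connected_in_def)
  then have "v = u \<or> (\<exists>w\<in>D. (u, w) \<in> E)" by induction auto
  then show ?thesis using assms(4) that by blast
qed

lemma connected_in_extend:
  assumes "sym E" "connected_in E B" "B \<subseteq> D" "D \<subseteq> reach E D B"
  shows "connected_in E D"
  unfolding connected_in_def
proof
  fix u assume "u \<in> D"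
  then have "u \<in> reach E D B" using assms(4) by blast
  then obtain b where b: "b \<in> B" "u \<in> reach E D {b}" by (rule reach_from_single)
  have "B \<subseteq> reach E B {b}" using assms(2) b(1) by (simp add: connected_in_def)
  also have "\<dots> \<subseteq> reach E D {b}" using assms(3) by (intro reach_mono) auto
  finally have "reach E D B \<subseteq> reach E D {b}" by (rule reach_trans)
  moreover have "reach E D {b} \<subseteq> reach E D {u}"
    using reach_sym[OF assms(1) b(2)] by (intro reach_trans) simp
  ultimately show "D \<subseteq> reach E D {u}" using assms(4) by blast
qed

lemma connected_in_Un:
  assumes "sym E" "connected_in E A" "connected_in E B" "a \<in> A" "b \<in> B" "a = b \<or> (a, b) \<in> E"
  shows "connected_in E (A \<union> B)"
proof (rule connected_in_extend[OF assms(1,2)])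
  have A: "A \<subseteq> reach E (A \<union> B) A" by (auto intro: reach.base)
  then have "{b} \<subseteq> reach E (A \<union> B) A" using assms(4-6) by (auto intro: reach.step)
  then have "reach E (A \<union> B) {b} \<subseteq> reach E (A \<union> B) A" by (rule reach_trans)
  moreover have "B \<subseteq> reach E (A \<union> B) {b}"
    using assms(3,5) reach_mono[of E E B "A \<union> B" "{b}" "{b}"] unfolding connected_in_def by blast
  ultimately show "A \<union> B \<subseteq> reach E (A \<union> B) A" using A by blast
qed simp

lemma connected_in_Un_reach:
  assumes "sym E" "connected_in E B" and P: "P \<subseteq> E `` (B \<union> reach E Z (E `` B))"
  shows "connected_in E (B \<union> P \<union> reach E Z (E `` B))"
proof (rule connected_in_extend[OF assms(1,2)])
  let ?D = "B \<union> P \<union> reach E Z (E `` B)"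
  have B: "B \<subseteq> reach E ?D B" by (auto intro: reach.base)
  have "v \<in> reach E ?D B" if "v \<in> reach E Z (E `` B)" for v
    using that
  proof induction
    case (base y)
    then have "y \<in> reach E Z (E `` B)" by (rule reach.base)
    then show ?case using base(1) B by (auto intro: reach.step)
  next
    case (step u v)
    then have "v \<in> reach E Z (E `` B)" by (blast intro: reach.step)
    then show ?case using step.IH step.hyps(2) by (auto intro: reach.step)
  qed
  then have "B \<union> reach E Z (E `` B) \<subseteq> reach E ?D B" using B by blast
  moreover from this have "P \<subseteq> E `` reach E ?D B" using P by blast
  then have "P \<subseteq> reach E ?D B" by (auto intro: reach.step)
  ultimately show "?D \<subseteq> reach E ?D B" by blast
qed auto

definition nbhd :: "'a rel \<Rightarrow> 'a set \<Rightarrow> 'a set" where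
  "nbhd E C = E `` C - C"

lemma nbhd_disjoint_iff:
  "sym E \<Longrightarrow> B \<inter> C = {} \<Longrightarrow> nbhd E C \<inter> B = {} \<longleftrightarrow> C \<inter> E `` B = {}"
  unfolding nbhd_def sym_def by blast

definition component :: "'a rel \<Rightarrow> 'a set \<Rightarrow> 'a set \<Rightarrow> bool" where
  "component E R C \<longleftrightarrow> C \<noteq> {} \<and> C \<subseteq> R \<and> connected_in E C \<and> nbhd E C \<inter> R = {}"

lemma component_reach:
  assumes "sym E" "v \<in> R"
  shows "component E R (reach E R {v})"
proof -
  have v: "v \<in> reach E R {v}" using assms(2) by (auto intro: reach.base)
  then have "connected_in E (reach E R {v})"
    using connected_in_extend[OF assms(1) connected_in_singleton[of E v]] reach_within_reach by fast
  moreover have "nbhd E (reach E R {v}) \<inter> R = {}"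
    by (auto simp: nbhd_def intro: reach.step)
  ultimately show ?thesis using v reach_subset[of E R "{v}"] by (auto simp: component_def)
qed

lemma component_maximal:
  assumes "component E R C" "D \<subseteq> R" "connected_in E D" "C \<inter> D \<noteq> {}"
  shows "D \<subseteq> C"
proof
  obtain u where u: "u \<in> C" "u \<in> D" using assms(4) by blast
  fix v assume "v \<in> D"
  then have "v \<in> reach E D {u}" using assms(3) u by (auto simp: connected_in_def)
  then show "v \<in> C"
    by induction (use u assms(1,2) in \<open>auto simp: component_def nbhd_def\<close>)
qed

lemma component_disjoint_reach:
  assumes "sym E" "component E R C" "C \<inter> X = {}"
  shows "C \<inter> reach E R X = {}"
proof -
  have "v \<notin> C" if "v \<in> reach E R X" for v
    using that
  proof induction
    case (base v)
    then show ?case using assms(3) by blast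
  next
    case (step u v)
    have "u \<in> R" using reach_subset step.hyps(1) by (rule subsetD)
    then have "u \<notin> nbhd E C" using assms(2) by (auto simp: component_def)
    then show ?case using step.IH symD[OF assms(1) step.hyps(2)] by (auto simp: nbhd_def)
  qed
  then show ?thesis by blast
qed

lemma component_Diff_cases:
  assumes E: "sym E" and C: "component E R C" and P: "P \<subseteq> C" and C': "component E (R - P) C'"
  obtains "component E R C'" | "component E (C - P) C'"
proof (cases "C \<inter> C' = {}")
  case True
  have "C' \<inter> E `` C = {}"
    using True C C' unfolding component_def nbhd_def by blast
  then have "nbhd E C' \<inter> C = {}" using nbhd_disjoint_iff[OF E True] by blast
  then have "component E R C'" using C' P by (auto simp: component_def)
  then show ?thesis by (rule that)
next
  case False
  then have "C' \<subseteq> C" using component_maximal[OF C] C' by (auto simp: component_def)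
  then have "component E (C - P) C'" using C C' by (auto simp: component_def)
  then show ?thesis by (rule that)
qed

lemma nbhd_component_Diff: "component E (C - P) C' \<Longrightarrow> nbhd E C' \<subseteq> nbhd E C \<union> P"
  by (auto simp: component_def nbhd_def)

section \<open>Separators and Menger's theorem\<close>

text \<open>The graph is the restriction of \<open>E\<close> to \<open>C\<close>, and \<open>P\<close> may meet \<open>X\<close> and \<open>Y\<close>.\<close>

definition separates :: "'a rel \<Rightarrow> 'a set \<Rightarrow> 'a set \<Rightarrow> 'a set \<Rightarrow> 'a set \<Rightarrow> bool" where
  "separates E C P X Y \<longleftrightarrow> reach E (C - P) X \<inter> Y = {}"

lemma separates_iff_reach_disjoint:
  assumes "sym E"
  shows "separates E C P X Y \<longleftrightarrow> reach E (C - P) X \<inter> reach E (C - P) Y = {}"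
proof
  assume sep: "separates E C P X Y"
  show "reach E (C - P) X \<inter> reach E (C - P) Y = {}"
  proof (rule ccontr)
    assume "reach E (C - P) X \<inter> reach E (C - P) Y \<noteq> {}"
    then obtain v where v: "v \<in> reach E (C - P) X" "v \<in> reach E (C - P) Y" by blast
    then obtain y where y: "y \<in> Y" "v \<in> reach E (C - P) {y}" by (metis reach_from_single)
    have "reach E (C - P) {v} \<subseteq> reach E (C - P) X" using v(1) by (intro reach_trans) simp
    then have "y \<in> reach E (C - P) X" using reach_sym[OF assms y(2)] by blast
    then show False using sep y(1) by (auto simp: separates_def)
  qed
next
  assume "reach E (C - P) X \<inter> reach E (C - P) Y = {}"
  moreover have "Y \<inter> (C - P) \<subseteq> reach E (C - P) Y" by (auto intro: reach.base)
  ultimately show "separates E C P X Y"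
    unfolding separates_def using reach_subset[of E "C - P" X] by blast
qed

lemma separates_commute: "sym E \<Longrightarrow> separates E C P X Y \<longleftrightarrow> separates E C P Y X"
  by (simp add: separates_iff_reach_disjoint Int_commute)

definition connectivity_at_least :: "'a rel \<Rightarrow> 'a set \<Rightarrow> nat \<Rightarrow> 'a set \<Rightarrow> 'a set \<Rightarrow> bool" where
  "connectivity_at_least E C k X Y \<longleftrightarrow> (\<forall>P\<subseteq>C. separates E C P X Y \<longrightarrow> k \<le> card P)"

lemma connectivity_at_leastD:
  "connectivity_at_least E C k X Y \<Longrightarrow> separates E C P X Y \<Longrightarrow> P \<subseteq> C \<Longrightarrow> k \<le> card P"
  by (simp add: connectivity_at_least_def)

lemma connectivity_at_least_commute:
  "sym E \<Longrightarrow> connectivity_at_least E C k X Y \<longleftrightarrow> connectivity_at_least E C k Y X"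
  by (simp add: connectivity_at_least_def separates_commute[of E C _ X Y])

definition minimal_separator :: "'a rel \<Rightarrow> 'a set \<Rightarrow> 'a set \<Rightarrow> 'a set \<Rightarrow> 'a set \<Rightarrow> bool" where
  "minimal_separator E C P X Y \<longleftrightarrow>
    P \<subseteq> C \<and> separates E C P X Y \<and> (\<forall>p\<in>P. \<not> separates E C (P - {p}) X Y)"

lemma minimal_separator_commute:
  "sym E \<Longrightarrow> minimal_separator E C P X Y \<longleftrightarrow> minimal_separator E C P Y X"
  by (simp add: minimal_separator_def separates_commute[of E C _ X Y])

lemma minimal_separator_exists:
  assumes "finite C" "\<not> connectivity_at_least E C k X Y"
  obtains P where "minimal_separator E C P X Y" "card P < k"
proof -
  let ?sep = "\<lambda>P. P \<subseteq> C \<and> separates E C P X Y"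
  obtain Q where Q: "?sep Q" "card Q < k"
    using assms(2) by (auto simp: connectivity_at_least_def not_le)
  obtain P where P: "?sep P" "\<And>P'. ?sep P' \<Longrightarrow> card P \<le> card P'"
    using ex_has_least_nat[of ?sep Q card] Q(1) by blast
  have "\<not> separates E C (P - {p}) X Y" if "p \<in> P" for p
  proof
    assume "separates E C (P - {p}) X Y"
    then have "card P \<le> card (P - {p})" using P by blast
    moreover have "finite P" using P(1) assms(1) finite_subset by blast
    ultimately show False using card_Diff1_less[OF _ that] by simp
  qed
  then have "minimal_separator E C P X Y" using P(1) by (simp add: minimal_separator_def)
  then show ?thesis using that P(2)[OF Q(1)] Q(2) by simp
qed

lemma minimal_separator_adjacent:
  assumes E: "sym E" and P: "minimal_separator E C P X Y"
  shows "P \<subseteq> Y \<union> E `` reach E (C - P) Y"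
proof (rule ccontr)
  assume "\<not> ?thesis"
  then obtain p where p: "p \<in> P" "p \<notin> Y" "p \<notin> E `` reach E (C - P) Y" by blast
  have "v \<in> reach E (C - P) Y" if "v \<in> reach E (C - (P - {p})) Y" for v
    using that
  proof induction
    case (base v)
    then show ?case using p(2) by (auto intro: reach.base)
  next
    case (step u v)
    then have "v \<noteq> p" using p(3) by blast
    then show ?case using step by (auto intro: reach.step)
  qed
  moreover have "separates E C P Y X" "\<not> separates E C (P - {p}) Y X"
    using P p(1) separates_commute[OF E, of C _ Y X] by (auto simp: minimal_separator_def)
  ultimately show False unfolding separates_def by blast
qed

lemma separator_nonempty:
  assumes "separates E C P X Y" "connected_in E C" "C \<inter> X \<noteq> {}" "C \<inter> Y \<noteq> {}"
  shows "P \<noteq> {}"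
proof
  assume "P = {}"
  obtain x where x: "x \<in> C" "x \<in> X" using assms(3) by blast
  have "C \<subseteq> reach E C {x}" using assms(2) x(1) by (simp add: connected_in_def)
  also have "\<dots> \<subseteq> reach E C X" using x by (intro reach_mono) auto
  finally show False using assms(1,4) \<open>P = {}\<close> by (auto simp: separates_def)
qed

definition linked ::
  "'a rel \<Rightarrow> 'a set \<Rightarrow> 'a set \<Rightarrow> 'a set \<Rightarrow> 'i set \<Rightarrow> ('i \<Rightarrow> 'a set) \<Rightarrow> bool" where
  "linked E C X Y I d \<longleftrightarrow> disjoint_family_on d I \<and>
    (\<forall>i\<in>I. d i \<subseteq> C \<and> connected_in E (d i) \<and> d i \<inter> X \<noteq> {} \<and> d i \<inter> Y \<noteq> {})"

lemma linkedD:
  assumes "linked E C X Y I d" "i \<in> I"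
  shows "d i \<subseteq> C" "connected_in E (d i)" "d i \<inter> X \<noteq> {}" "d i \<inter> Y \<noteq> {}"
  using assms by (auto simp: linked_def)

lemma linked_mono:
  assumes "linked E C X Y I d" "E \<subseteq> E'" "C \<subseteq> C'" shows "linked E' C' X Y I d"
  using assms unfolding linked_def by (meson connected_in_mono order_trans)

lemma linked_reindex:
  assumes "linked E C X Y I d" "inj_on g J" "g ` J \<subseteq> I"
  shows "linked E C X Y J (d \<circ> g)"
  using assms unfolding linked_def disjoint_family_on_def inj_on_def
  by (simp add: image_subset_iff) blast

lemma linked_indexed_by_ends:
  assumes d: "linked E C X Y I d" and card: "card I = card Y" and fin: "finite I" "finite Y"
  obtains d' where "linked E C X Y Y d'" "\<forall>y\<in>Y. y \<in> d' y"
proof -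
  have "\<forall>i\<in>I. \<exists>y. y \<in> d i \<inter> Y" using linkedD(4)[OF d] by blast
  then obtain g where g: "\<And>i. i \<in> I \<Longrightarrow> g i \<in> d i \<inter> Y" by metis
  have inj: "inj_on g I"
  proof (rule inj_onI, rule ccontr)
    fix i j assume ij: "i \<in> I" "j \<in> I" "g i = g j" "i \<noteq> j"
    then have "d i \<inter> d j = {}" using d by (auto simp: linked_def dest: disjoint_family_onD)
    then show False using g[of i] g[of j] ij by auto
  qed
  then have img: "g ` I = Y"
    using g card fin by (intro card_subset_eq) (auto simp: card_image)
  let ?h = "inv_into I g"
  have "linked E C X Y Y (d \<circ> ?h)"
    using inj_on_inv_into[of Y g I] inv_into_into[of _ g I] img
    by (intro linked_reindex[OF d]) auto
  moreover have "\<forall>y\<in>Y. y \<in> (d \<circ> ?h) y"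
  proof
    fix y assume y: "y \<in> Y"
    then have "g (?h y) = y" "?h y \<in> I" using img by (auto intro: f_inv_into_f inv_into_into)
    then show "y \<in> (d \<circ> ?h) y" using g[of "?h y"] by simp
  qed
  ultimately show ?thesis by (rule that)
qed

lemma deleted_edge_one_end_reached:
  assumes sep: "separates (E - {(u, v), (v, u)}) C S X Y" and nsep: "\<not> separates E C S X Y"
  defines "A \<equiv> reach (E - {(u, v), (v, u)}) (C - S) X"
  shows "u \<in> A \<longleftrightarrow> v \<notin> A"
proof (rule ccontr)
  assume n: "\<not> ?thesis"
  have "reach E (C - S) X \<subseteq> A"
  proof
    fix w assume "w \<in> reach E (C - S) X"
    then show "w \<in> A"
    proof induction
      case (step a b)
      then show ?case
        using n reach.step[of a "E - {(u, v), (v, u)}" "C - S" X b] unfolding A_def by blast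
    qed (auto simp: A_def intro: reach.base)
  qed
  then show False using sep nsep unfolding separates_def A_def by blast
qed

lemma deleted_edge_joins_sides:
  fixes E u v
  defines "E' \<equiv> E - {(u, v), (v, u)}"
  assumes E: "sym E" and sep: "separates E' C S X Y" and nsep: "\<not> separates E C S X Y"
  obtains x y where "{(x, y), (y, x)} = {(u, v), (v, u)}"
    "x \<in> reach E' (C - S) X" "y \<in> reach E' (C - S) Y"
proof -
  have E': "sym E'" using E by (auto simp: E'_def sym_def)
  have "reach E' (C - S) X \<inter> reach E' (C - S) Y = {}"
    using sep separates_iff_reach_disjoint[OF E'] by blast
  moreover have "u \<in> reach E' (C - S) X \<longleftrightarrow> v \<notin> reach E' (C - S) X"
    using deleted_edge_one_end_reached sep nsep unfolding E'_def by metis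
  moreover have "u \<in> reach E' (C - S) Y \<longleftrightarrow> v \<notin> reach E' (C - S) Y"
    using deleted_edge_one_end_reached[of E u v C S Y X] sep nsep
      separates_commute[OF E] separates_commute[OF E'] unfolding E'_def by metis
  ultimately show ?thesis using that by blast
qed

lemma separates_insert_end:
  assumes "separates (E - {(x, y), (y, x)}) C S X Y"
  shows "separates E C (insert x S) X Y"
proof -
  have "v \<in> reach (E - {(x, y), (y, x)}) (C - S) X" if "v \<in> reach E (C - insert x S) X" for v
    using that
  proof induction
    case (step a b)
    have "a \<noteq> x" using step.hyps(1) reach_subset by fast
    then show ?case using step by (auto intro: reach.step)
  qed (auto intro: reach.base)
  then show ?thesis using assms unfolding separates_def by blast
qed

lemma separates_from_side:
  fixes E C S X Y x y
  defines "E' \<equiv> E - {(x, y), (y, x)}"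
  defines "A \<equiv> reach E' (C - S) X"
  assumes E: "sym E" and S: "separates E' C S X Y"
    and y: "y \<in> reach E' (C - S) Y" and P: "separates E' (A \<union> S) P X (insert x S)"
  shows "separates E C P X Y"
proof -
  let ?Z = "reach E' (A \<union> S - P) X"
  have "sym E'" using E by (auto simp: E'_def sym_def)
  then have disj: "A \<inter> reach E' (C - S) Y = {}"
    using S separates_iff_reach_disjoint unfolding A_def by blast
  have Z: "?Z \<subseteq> A - insert x S"
    using P reach_subset[of E' "A \<union> S - P" X] unfolding separates_def by blast
  have "v \<in> ?Z" if "v \<in> reach E (C - P) X" for v
    using that
  proof induction
    case (base v)
    then show ?case unfolding A_def by (auto intro: reach.base)
  next
    case (step a b)
    then have a: "a \<in> A" "a \<noteq> x" "a \<noteq> y" using Z y disj by blast+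
    then have ab: "(a, b) \<in> E'" using step.hyps(2) by (simp add: E'_def)
    moreover have "b \<in> A \<union> S" using a(1) ab step.hyps(3) by (auto simp: A_def intro: reach.step)
    ultimately show ?case using step by (auto intro: reach.step)
  qed
  moreover have "A \<inter> Y \<subseteq> reach E' (C - S) Y"
    using reach_subset[of E' "C - S" X] by (auto simp: A_def intro: reach.base)
  ultimately show ?thesis using Z disj unfolding separates_def by blast
qed

lemma connectivity_at_least_side:
  fixes E C S X Y x y
  defines "E' \<equiv> E - {(x, y), (y, x)}"
  defines "A \<equiv> reach E' (C - S) X"
  assumes "sym E" "connectivity_at_least E C k X Y" "S \<subseteq> C" "separates E' C S X Y"
    "y \<in> reach E' (C - S) Y"
  shows "connectivity_at_least E' (A \<union> S) k X (insert x S)"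
  unfolding connectivity_at_least_def
proof (intro allI impI)
  fix P assume P: "P \<subseteq> A \<union> S" "separates E' (A \<union> S) P X (insert x S)"
  have "separates E C P X Y"
    using separates_from_side assms(3,6,7) P(2) unfolding E'_def A_def by metis
  moreover have "P \<subseteq> C" using P(1) assms(5) reach_subset[of E' "C - S" X] by (auto simp: A_def)
  ultimately show "k \<le> card P" by (rule connectivity_at_leastD[OF assms(4)])
qed

lemma linked_glue:
  assumes E: "sym E" and AB: "A \<inter> B = {}" "A \<inter> S = {}" "B \<inter> S = {}"
    and x: "x \<in> A" and y: "y \<in> B" and xy: "(x, y) \<in> E"
    and d: "linked E (A \<union> S) X (insert x S) (insert x S) d" "\<forall>s\<in>insert x S. s \<in> d s"
    and e: "linked E (B \<union> S) Y (insert y S) (insert y S) e" "\<forall>s\<in>insert y S. s \<in> e s"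
  defines "h \<equiv> \<lambda>s. if s = x then y else s"
  shows "linked E (A \<union> B \<union> S) X Y (insert x S) (\<lambda>s. d s \<union> e (h s))"
proof -
  have hS: "h s \<in> insert y S" if "s \<in> insert x S" for s using that by (auto simp: h_def)
  have inj: "h s \<noteq> h s'" if "s \<in> insert x S" "s' \<in> insert x S" "s \<noteq> s'" for s s'
    using that AB y by (auto simp: h_def)
  have disj: "d s \<inter> d s' = {}" "e (h s) \<inter> e (h s') = {}"
    if "s \<in> insert x S" "s' \<in> insert x S" "s \<noteq> s'" for s s'
    using d(1) e(1) disjoint_family_onD that hS inj unfolding linked_def by metis+
  have meet: "s = s'" if s: "s \<in> insert x S" "s' \<in> insert x S" "v \<in> d s" "v \<in> e (h s')" for s s' v
  proof -
    have "v \<in> S" using linkedD(1)[OF d(1) s(1)] linkedD(1)[OF e(1) hS[OF s(2)]] s AB by blast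
    moreover from this have "v \<in> d v" "v \<in> e (h v)" using d(2) e(2) AB x by (auto simp: h_def)
    ultimately have "v = s" "v = s'" using disj(1)[of v s] disj(2)[of v s'] s by blast+
    then show ?thesis by simp
  qed
  have "disjoint_family_on (\<lambda>s. d s \<union> e (h s)) (insert x S)"
    unfolding disjoint_family_on_def
  proof (intro ballI impI)
    fix s s' assume s: "s \<in> insert x S" "s' \<in> insert x S" "s \<noteq> s'"
    then show "(d s \<union> e (h s)) \<inter> (d s' \<union> e (h s')) = {}"
      using disj[OF s] meet[of s s'] meet[of s' s] by blast
  qed
  moreover have "connected_in E (d s \<union> e (h s))" if s: "s \<in> insert x S" for s
  proof (rule connected_in_Un[OF E linkedD(2)[OF d(1) s] linkedD(2)[OF e(1) hS[OF s]]])
    show "s \<in> d s" "h s \<in> e (h s)" "s = h s \<or> (s, h s) \<in> E"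
      using d(2) e(2) s hS[OF s] xy by (auto simp: h_def)
  qed
  moreover have "d s \<union> e (h s) \<subseteq> A \<union> B \<union> S" "(d s \<union> e (h s)) \<inter> X \<noteq> {}" "(d s \<union> e (h s)) \<inter> Y \<noteq> {}"
    if s: "s \<in> insert x S" for s
    using linkedD[OF d(1) s] linkedD[OF e(1) hS[OF s]] by blast+
  ultimately show ?thesis unfolding linked_def by blast
qed

definition k_linked :: "'a rel \<Rightarrow> 'a set \<Rightarrow> nat \<Rightarrow> 'a set \<Rightarrow> 'a set \<Rightarrow> bool" where
  "k_linked E C k X Y \<longleftrightarrow> (\<exists>(I :: 'a set) d. finite I \<and> card I = k \<and> linked E C X Y I d)"

lemma k_linked_lessThan:
  fixes E :: "'a rel"
  assumes "k_linked E C k X Y"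
  obtains d where "linked E C X Y {..<k} d"
proof -
  obtain I :: "'a set" and d where I: "finite I" "card I = k" and d: "linked E C X Y I d"
    using assms unfolding k_linked_def by blast
  obtain g where g: "bij_betw g {..<k} I"
    using ex_bij_betw_nat_finite[OF I(1)] I(2) by (auto simp: lessThan_atLeast0)
  have "linked E C X Y {..<k} (d \<circ> g)"
    using g by (intro linked_reindex[OF d]) (auto simp: bij_betw_def)
  then show ?thesis by (rule that)
qed

lemma linked_to_separator:
  fixes E C S X Y x y
  defines "E' \<equiv> E - {(x, y), (y, x)}"
  defines "A \<equiv> reach E' (C - S) X"
  assumes E: "sym E" and C: "finite C" and conn: "connectivity_at_least E C k X Y"
    and S: "S \<subseteq> C" "separates E' C S X Y" "card (insert x S) = k"
    and y: "y \<in> reach E' (C - S) Y"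
    and IH: "connectivity_at_least E' (A \<union> S) k X (insert x S) \<Longrightarrow>
      k_linked E' (A \<union> S) k X (insert x S)"
  obtains d where "linked E (A \<union> S) X (insert x S) (insert x S) d" "\<forall>s\<in>insert x S. s \<in> d s"
proof -
  have "connectivity_at_least E' (A \<union> S) k X (insert x S)"
    using connectivity_at_least_side[OF E conn S(1)] S(2) y unfolding E'_def A_def by blast
  then obtain I :: "'a set" and d where I: "finite I" "card I = k"
    "linked E' (A \<union> S) X (insert x S) I d"
    using IH unfolding k_linked_def by blast
  have "linked E (A \<union> S) X (insert x S) I d"
    using I(3) by (rule linked_mono) (auto simp: E'_def)
  moreover have "finite (insert x S)" using S(1) C finite_subset by blast
  ultimately show ?thesis
    using linked_indexed_by_ends that I(1,2) S(3) by metis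
qed

lemma k_linked_across_separator:
  fixes E C S X Y x y
  defines "E' \<equiv> E - {(x, y), (y, x)}"
  assumes E: "sym E" "(x, y) \<in> E" and C: "finite C" and conn: "connectivity_at_least E C k X Y"
    and S: "S \<subseteq> C" "separates E' C S X Y" "card S < k"
    and xy: "x \<in> reach E' (C - S) X" "y \<in> reach E' (C - S) Y"
    and IH: "\<And>D X Y. D \<subseteq> C \<Longrightarrow> connectivity_at_least E' D k X Y \<Longrightarrow> k_linked E' D k X Y"
  shows "k_linked E C k X Y"
proof -
  let ?A = "reach E' (C - S) X" and ?B = "reach E' (C - S) Y"
  have sides: "?A \<subseteq> C - S" "?B \<subseteq> C - S" by (rule reach_subset)+
  then have sub: "?A \<union> S \<subseteq> C" "?B \<union> S \<subseteq> C" and new: "x \<notin> S" "y \<notin> S" using S(1) xy by blast+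
  have finS: "finite S" using S(1) C by (rule finite_subset)
  have "separates E C (insert x S) X Y" using S(2) separates_insert_end unfolding E'_def by metis
  then have "k \<le> card (insert x S)"
    using sub(1) xy(1) by (intro connectivity_at_leastD[OF conn]) auto
  then have card: "card (insert x S) = k" "card (insert y S) = k" using S(3) finS new by auto
  obtain d where d: "linked E (?A \<union> S) X (insert x S) (insert x S) d" "\<forall>s\<in>insert x S. s \<in> d s"
    using linked_to_separator[OF E(1) C conn S(1) _ card(1)] S(2) xy(2) IH[OF sub(1)]
    unfolding E'_def by metis
  have E': "sym E'" "E' = E - {(y, x), (x, y)}" using E by (auto simp: E'_def sym_def)
  then have "connectivity_at_least E C k Y X" "separates E' C S Y X"
    using conn S(2) connectivity_at_least_commute[OF E(1)] separates_commute by blast+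
  then obtain e where e: "linked E (?B \<union> S) Y (insert y S) (insert y S) e" "\<forall>s\<in>insert y S. s \<in> e s"
    using linked_to_separator[OF E(1) C _ S(1) _ card(2)] xy(1) IH[OF sub(2)] E'(2) by metis
  have "?A \<inter> ?B = {}" using S(2) separates_iff_reach_disjoint[OF E'(1)] by blast
  from linked_glue[OF E(1) this _ _ xy E(2) d e]
  have "linked E (?A \<union> ?B \<union> S) X Y (insert x S) (\<lambda>s. d s \<union> e (if s = x then y else s))"
    using sides by blast
  then have "linked E C X Y (insert x S) (\<lambda>s. d s \<union> e (if s = x then y else s))"
    using sub by (elim linked_mono) auto
  then show ?thesis using card(1) finS unfolding k_linked_def by (metis finite_insert)
qed

lemma k_linked_edgeless:
  assumes "finite C" "E \<inter> C \<times> C = {}" "connectivity_at_least E C k X Y"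
  shows "k_linked E C k X Y"
proof -
  let ?P = "C \<inter> X \<inter> Y"
  have "v \<in> X" if "v \<in> reach E (C - ?P) X" for v
    using that
  proof cases
    case (step u)
    then show ?thesis using assms(2) reach_subset[of E "C - ?P" X] by blast
  qed
  then have "separates E C ?P X Y"
    using reach_subset[of E "C - ?P" X] unfolding separates_def by blast
  then have "k \<le> card ?P" by (rule connectivity_at_leastD[OF assms(3)]) blast
  then obtain I where "I \<subseteq> ?P" "card I = k" "finite I" by (metis obtain_subset_with_card_n)
  moreover from this have "linked E C X Y I (\<lambda>v. {v})"
    by (auto simp: linked_def disjoint_family_on_def)
  ultimately show ?thesis unfolding k_linked_def by blast
qed

text \<open>
  Paths are replaced by disjoint connected sets, which is all that a minor needs. A deleted edge
  \<open>xy\<close> that lowers the connectivity below \<open>k\<close> leaves a separator \<open>S\<close> of size \<open>k - 1\<close>; the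
  induction hypothesis links \<open>X\<close> to \<open>S \<union> {x}\<close> and \<open>Y\<close> to \<open>S \<union> {y}\<close> on the two sides of \<open>S\<close>.
\<close>

theorem menger:
  assumes "finite C" "sym E" "connectivity_at_least E C k X Y"
  shows "k_linked E C k X Y"
  using assms
proof (induction "card (E \<inter> C \<times> C)" arbitrary: E C X Y rule: less_induct)
  case less
  note fin = \<open>finite C\<close>
  show ?case
  proof (cases "E \<inter> C \<times> C = {}")
    case True
    then show ?thesis using k_linked_edgeless fin less.prems(3) by blast
  next
    case False
    then obtain u v where uv: "(u, v) \<in> E" "u \<in> C" "v \<in> C" by blast
    define E' where "E' = E - {(u, v), (v, u)}"
    have E': "sym E'" "E' \<subseteq> E" using less.prems(2) by (auto simp: E'_def sym_def)
    have IH: "k_linked E' D k X Y" if D: "D \<subseteq> C" "connectivity_at_least E' D k X Y" for D X Y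
    proof (rule less.hyps)
      show "card (E' \<inter> D \<times> D) < card (E \<inter> C \<times> C)"
        using uv D(1) fin by (intro psubset_card_mono) (auto simp: E'_def)
      show "finite D" using D(1) fin by (rule finite_subset)
    qed (fact E'(1) D(2))+
    show ?thesis
    proof (cases "connectivity_at_least E' C k X Y")
      case True
      then have "k_linked E' C k X Y" by (rule IH[OF order_refl])
      then show ?thesis unfolding k_linked_def using linked_mono[OF _ E'(2) order_refl] by metis
    next
      case False
      then obtain S where S: "S \<subseteq> C" "separates E' C S X Y" "card S < k"
        by (auto simp: connectivity_at_least_def not_le)
      then have "\<not> separates E C S X Y"
        using connectivity_at_leastD[OF less.prems(3)] by (meson not_le)
      then obtain x y where xy: "{(x, y), (y, x)} = {(u, v), (v, u)}"
        "x \<in> reach E' (C - S) X" "y \<in> reach E' (C - S) Y"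
        using deleted_edge_joins_sides[OF less.prems(2)] S(2) unfolding E'_def by metis
      have E'_eq: "E' = E - {(x, y), (y, x)}" unfolding E'_def xy(1) ..
      have "(x, y) \<in> {(u, v), (v, u)}" unfolding xy(1)[symmetric] by simp
      then have "(x, y) \<in> E" using uv(1) symD[OF less.prems(2)] by auto
      then show ?thesis
        using S(2,3) xy(2,3) IH unfolding E'_eq
        by (rule k_linked_across_separator[OF less.prems(2) _ fin less.prems(3) S(1)])
    qed
  qed
qed

section \<open>Minors from branch sets\<close>

lemma pair_graph_iff:
  "pair_graph G \<longleftrightarrow>
    finite (pverts G) \<and> parcs G \<subseteq> pverts G \<times> pverts G \<and> sym (parcs G) \<and> irrefl (parcs G)"
proof
  assume "pair_graph G"
  then interpret pair_graph G .
  show "finite (pverts G) \<and> parcs G \<subseteq> pverts G \<times> pverts G \<and> sym (parcs G) \<and> irrefl (parcs G)"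
    using no_loops' by (auto simp: sym_def irrefl_def intro: arcs_symmetric dest: wellformed')
next
  assume r: "finite (pverts G) \<and> parcs G \<subseteq> pverts G \<times> pverts G \<and> sym (parcs G) \<and> irrefl (parcs G)"
  then have "finite (parcs G)" by (meson finite_SigmaI finite_subset)
  with r show "pair_graph G"
    by unfold_locales (auto simp: irrefl_def symmetric_def)
qed

definition graph_image :: "('a \<Rightarrow> 'b) \<Rightarrow> 'a pair_pre_digraph \<Rightarrow> 'b pair_pre_digraph" where
  "graph_image f G = \<lparr> pverts = f ` pverts G, parcs = map_prod f f ` parcs G - Id \<rparr>"

lemma pverts_graph_image [simp]: "pverts (graph_image f G) = f ` pverts G"
  by (simp add: graph_image_def)

lemma parcs_graph_image: "parcs (graph_image f G) = map_prod f f ` parcs G - Id"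
  by (simp add: graph_image_def)

lemma graph_image_comp: "graph_image g (graph_image f G) = graph_image (g \<circ> f) G"
proof -
  have "map_prod g g ` (map_prod f f ` E - Id) - Id = map_prod (g \<circ> f) (g \<circ> f) ` E - Id" for E
    by (force simp: image_iff)
  then show ?thesis by (simp add: graph_image_def image_comp)
qed

lemma graph_image_cong:
  assumes "pair_graph G" "\<And>x. x \<in> pverts G \<Longrightarrow> f x = g x"
  shows "graph_image f G = graph_image g G"
proof -
  have "map_prod f f ` parcs G = map_prod g g ` parcs G"
    using assms by (intro image_cong) (auto simp: pair_graph_iff)
  then show ?thesis using assms(2) by (simp add: graph_image_def)
qed

lemma graph_image_id: "pair_graph G \<Longrightarrow> graph_image id G = G"
  by (intro pair_pre_digraph.equality)
    (auto simp: pair_graph_iff parcs_graph_image map_prod.id irrefl_def)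

lemma pair_graph_image:
  assumes "pair_graph G" shows "pair_graph (graph_image f G)"
proof -
  have "sym (map_prod f f ` parcs G - Id)"
    using assms by (force simp: pair_graph_iff sym_def)
  then show ?thesis
    using assms unfolding pair_graph_iff by (auto simp: parcs_graph_image irrefl_def)
qed

lemma contract_edge_eq_image:
  "contract_edge u v G = graph_image (\<lambda>x. if x = v then u else x) G"
proof -
  have "{(f x, f y) | x y. (x, y) \<in> E \<and> f x \<noteq> f y} = map_prod f f ` E - Id"
    for f :: "'a \<Rightarrow> 'a" and E
    by force
  then show ?thesis by (simp add: contract_edge_def graph_image_def Let_def)
qed

lemma digraph_iso_graph_image:
  assumes "pair_graph G" "inj_on f (pverts G)"
  shows "digraph_iso (with_proj G) (with_proj (graph_image f G))"
proof -
  interpret pair_graph G by fact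
  have arcs: "parcs G \<subseteq> pverts G \<times> pverts G" "irrefl (parcs G)"
    using assms(1) by (auto simp: pair_graph_iff)
  let ?h = "\<lparr> iso_verts = f, iso_arcs = map_prod f f, iso_head = snd, iso_tail = fst \<rparr>"
  have "inj_on (map_prod f f) (parcs G)"
    using map_prod_inj_on[OF assms(2) assms(2)] arcs(1) by (rule inj_on_subset)
  then have "pre_digraph.digraph_isomorphism (with_proj G) ?h"
    using assms(2) wf_digraph_axioms by (simp add: pre_digraph.digraph_isomorphism_def)
  moreover have "f x \<noteq> f y" if "(x, y) \<in> parcs G" for x y
    using that arcs assms(2) by (metis SigmaE2 inj_on_eq_iff irrefl_def subsetD)
  then have "map_prod f f ` parcs G = parcs (graph_image f G)"
    by (auto simp: parcs_graph_image)
  then have "with_proj (graph_image f G) = app_iso ?h (with_proj G)"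
    by (simp add: app_iso_def with_proj_def)
  ultimately show ?thesis unfolding digraph_iso_def by blast
qed

lemma subgraph_with_projI:
  assumes "pair_graph S" "pair_graph G" "pverts S \<subseteq> pverts G" "parcs S \<subseteq> parcs G"
  shows "subgraph (with_proj S) (with_proj G)"
proof -
  interpret S: pair_graph S by fact
  interpret G: pair_graph G by fact
  show ?thesis using assms S.wf_digraph_axioms G.wf_digraph_axioms
    by (auto simp: subgraph_def)
qed

lemma contracts_to_trans:
  assumes "contracts_to M N" "contracts_to G M" shows "contracts_to G N"
  using assms by induction (auto intro: contracts_to.step)

lemma connected_in_graph_image:
  assumes "connected_in (parcs G) D"
  shows "connected_in (parcs (graph_image f G)) (f ` D)"
proof -
  have "f v \<in> reach (parcs (graph_image f G)) (f ` D) {f u}" if "v \<in> reach (parcs G) D {u}" for u v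
    using that
  proof induction
    case (step a b)
    show ?case
    proof (cases "f a = f b")
      case False
      then have "(f a, f b) \<in> parcs (graph_image f G)"
        using step.hyps(2) by (force simp: parcs_graph_image)
      then show ?thesis using step.IH step.hyps(3) by (blast intro: reach.step)
    qed (use step.IH in simp)
  qed (auto intro: reach.base)
  then show ?thesis using assms unfolding connected_in_def by blast
qed

lemma contracts_to_connected_fibres:
  assumes "pair_graph S" "\<And>i. connected_in (parcs S) {v \<in> pverts S. f v = i}"
  shows "\<exists>M. contracts_to S M \<and> pair_graph M \<and> inj_on f (pverts M) \<and>
    graph_image f M = graph_image f S"
  using assms
proof (induction "card (pverts S)" arbitrary: S rule: less_induct)
  case less
  show ?case
  proof (cases "inj_on f (pverts S)")
    case True
    then show ?thesis using contracts_to.refl less.prems(1) by blast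
  next
    case False
    then obtain u v where uv: "u \<in> pverts S" "v \<in> pverts S" "f v = f u" "u \<noteq> v"
      by (auto simp: inj_on_def)
    obtain w where w: "(u, w) \<in> parcs S" "f w = f u"
      using connected_in_neighbour[OF less.prems(2)[of "f u"], of u v] uv by auto
    define c where "c x = (if x = w then u else x)" for x
    define S' where "S' = contract_edge u w S"
    have S': "S' = graph_image c S" unfolding S'_def contract_edge_eq_image c_def by simp
    have S: "finite (pverts S)" "w \<in> pverts S" "u \<noteq> w"
      using less.prems(1) w by (auto simp: pair_graph_iff irrefl_def)
    have fc: "f (c x) = f x" for x using w(2) by (simp add: c_def)
    have "pverts S' = pverts S - {w}" using uv S by (auto simp: S' c_def)
    then have "card (pverts S') < card (pverts S)" using S by (metis card_Diff1_less)
    moreover have "pair_graph S'" using less.prems(1) unfolding S' by (rule pair_graph_image)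
    moreover have "connected_in (parcs S') {v \<in> pverts S'. f v = i}" for i
    proof -
      have "{v \<in> pverts S'. f v = i} = c ` {v \<in> pverts S. f v = i}" by (auto simp: S' fc)
      then show ?thesis using connected_in_graph_image[OF less.prems(2)] unfolding S' by simp
    qed
    ultimately obtain M where M: "contracts_to S' M" "pair_graph M" "inj_on f (pverts M)"
      "graph_image f M = graph_image f S'" using less.hyps by blast
    have "contracts_to S M"
      using M(1) contracts_to.step[OF contracts_to.refl w(1)] unfolding S'_def
      by (rule contracts_to_trans)
    moreover have "graph_image f M = graph_image f S"
      unfolding M(4) unfolding S' graph_image_comp by (simp add: comp_def fc)
    ultimately show ?thesis using M by blast
  qed
qed

lemma is_minor_graph_image:
  assumes G: "pair_graph G" and S: "pair_graph S" "pverts S \<subseteq> pverts G" "parcs S \<subseteq> parcs G"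
    and fibres: "\<And>i. connected_in (parcs S) {v \<in> pverts S. f v = i}"
  shows "is_minor (graph_image f S) G"
proof -
  obtain M where M: "contracts_to S M" "pair_graph M" "inj_on f (pverts M)"
    "graph_image f M = graph_image f S"
    using contracts_to_connected_fibres[OF S(1) fibres] by blast
  let ?g = "inv_into (pverts M) f"
  have "graph_image ?g (graph_image f S) = graph_image (?g \<circ> f) M"
    unfolding M(4)[symmetric] graph_image_comp ..
  also have "\<dots> = graph_image id M" using M by (intro graph_image_cong) auto
  also have "\<dots> = M" using M(2) by (rule graph_image_id)
  finally have "graph_image ?g (graph_image f S) = M" .
  moreover have "inj_on ?g (pverts (graph_image f S))"
    unfolding M(4)[symmetric] by (simp add: inj_on_inv_into)
  ultimately have "digraph_iso (with_proj (graph_image f S)) (with_proj M)"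
    using digraph_iso_graph_image[OF pair_graph_image[OF S(1)]] by metis
  then show ?thesis
    unfolding is_minor_def using S(1) M(1) subgraph_with_projI[OF S(1) G S(2,3)] by blast
qed

definition minor_model :: "'b pair_pre_digraph \<Rightarrow> 'a pair_pre_digraph \<Rightarrow> ('b \<Rightarrow> 'a set) \<Rightarrow> bool" where
  "minor_model X G D \<longleftrightarrow> disjoint_family_on D (pverts X) \<and>
    (\<forall>i\<in>pverts X. D i \<noteq> {} \<and> D i \<subseteq> pverts G \<and> connected_in (parcs G) (D i)) \<and>
    (\<forall>(i, j)\<in>parcs X. parcs G `` D i \<inter> D j \<noteq> {})"

lemma minor_model_subgraph:
  assumes X: "pair_graph X" and G: "pair_graph G" and D: "minor_model X G D"
  obtains S f where "pair_graph S" "pverts S \<subseteq> pverts G" "parcs S \<subseteq> parcs G"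
    "\<And>i. i \<in> pverts X \<Longrightarrow> Restr (parcs G) (D i) \<subseteq> parcs S"
    "\<And>i. {x \<in> pverts S. f x = i} = (if i \<in> pverts X then D i else {})" "graph_image f S = X"
proof -
  have branch: "D i \<noteq> {}" "D i \<subseteq> pverts G" if "i \<in> pverts X" for i
    using D that by (auto simp: minor_model_def)
  define f where "f x = (THE i. i \<in> pverts X \<and> x \<in> D i)" for x
  have f: "f x = i" if "i \<in> pverts X" "x \<in> D i" for x i
    unfolding f_def using that D
    by (intro the_equality) (auto simp: minor_model_def disjoint_family_on_def)
  define S where "S = \<lparr> pverts = \<Union> (D ` pverts X),
    parcs = {(x, y) \<in> Restr (parcs G) (\<Union> (D ` pverts X)). f x = f y \<or> (f x, f y) \<in> parcs X} \<rparr>"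
  have sub: "pverts S \<subseteq> pverts G" "parcs S \<subseteq> parcs G" using branch(2) by (auto simp: S_def)
  moreover have "pair_graph S"
    using X G sub(1) finite_subset[OF sub(1)]
    unfolding pair_graph_iff by (auto simp: S_def sym_def irrefl_def)
  moreover have "Restr (parcs G) (D i) \<subseteq> parcs S" if "i \<in> pverts X" for i
    using f[OF that] that by (auto simp: S_def)
  moreover have "{x \<in> pverts S. f x = i} = (if i \<in> pverts X then D i else {})" for i
    using f by (auto simp: S_def)
  moreover have "graph_image f S = X"
  proof (rule pair_pre_digraph.equality)
    show "pverts (graph_image f S) = pverts X"
      using f branch(1) by (force simp: S_def image_iff)
    show "parcs (graph_image f S) = parcs X"
    proof (intro subset_antisym subrelI)
      fix i j assume ij: "(i, j) \<in> parcs X"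
      then obtain x y where xy: "x \<in> D i" "y \<in> D j" "(x, y) \<in> parcs G"
        using D by (fastforce simp: minor_model_def)
      have V: "i \<in> pverts X" "j \<in> pverts X" "i \<noteq> j"
        using X ij by (auto simp: pair_graph_iff irrefl_def)
      then have "f x = i" "f y = j" using f xy by auto
      moreover from this have "(x, y) \<in> parcs S" using V xy ij by (auto simp: S_def)
      ultimately show "(i, j) \<in> parcs (graph_image f S)"
        using V(3) by (force simp: parcs_graph_image)
    qed (auto simp: parcs_graph_image S_def)
  qed simp
  ultimately show ?thesis using that by blast
qed

lemma minor_model_imp_is_minor:
  assumes X: "pair_graph X" and G: "pair_graph G" and D: "minor_model X G D"
  shows "is_minor X G"
proof -
  obtain S f where S: "pair_graph S" "pverts S \<subseteq> pverts G" "parcs S \<subseteq> parcs G"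
    and arcs: "\<And>i. i \<in> pverts X \<Longrightarrow> Restr (parcs G) (D i) \<subseteq> parcs S"
    and fibre: "\<And>i. {x \<in> pverts S. f x = i} = (if i \<in> pverts X then D i else {})"
    and X_eq: "graph_image f S = X"
    by (rule minor_model_subgraph[OF X G D]) (rule that)
  have "connected_in (parcs S) {x \<in> pverts S. f x = i}" for i
  proof (cases "i \<in> pverts X")
    case True
    then have "connected_in (parcs G) (D i)" using D by (simp add: minor_model_def)
    then have "connected_in (parcs S) (D i)"
      using connected_in_mono[OF connected_in_Restr arcs[OF True]] by blast
    then show ?thesis using True by (simp add: fibre)
  qed (simp add: fibre)
  then have "is_minor (graph_image f S) G" by (rule is_minor_graph_image[OF G S])
  then show ?thesis unfolding X_eq .
qed

lemma pair_graph_K2_star: "pair_graph (K2_star t)"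
  by (auto simp: pair_graph_iff K2_star_def sym_def irrefl_def)

lemma
  shows pverts_K2_star: "pverts (K2_star t) = insert 0 (insert 1 ((\<lambda>i. Suc (Suc i)) ` {..<t}))"
    and parcs_K2_star: "parcs (K2_star t) = {(0, 1), (1, 0)} \<union>
      {0, 1} \<times> (\<lambda>i. Suc (Suc i)) ` {..<t} \<union> (\<lambda>i. Suc (Suc i)) ` {..<t} \<times> {0, 1}"
proof -
  have "{2..<t + 2} = (\<lambda>i. Suc (Suc i)) ` {..<t}"
    using image_Suc_atLeastLessThan
    by (simp add: lessThan_atLeast0 numeral_2_eq_2 flip: image_image)
  then show "pverts (K2_star t) = insert 0 (insert 1 ((\<lambda>i. Suc (Suc i)) ` {..<t}))"
    "parcs (K2_star t) = {(0, 1), (1, 0)} \<union>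
      {0, 1} \<times> (\<lambda>i. Suc (Suc i)) ` {..<t} \<union> (\<lambda>i. Suc (Suc i)) ` {..<t} \<times> {0, 1}"
    by (auto simp: K2_star_def)
qed

lemma is_minor_K2_starI:
  assumes G: "pair_graph G"
    and A: "connected_in (parcs G) A" "A \<subseteq> pverts G"
    and B: "connected_in (parcs G) B" "B \<subseteq> pverts G"
    and AB: "A \<inter> B = {}" "parcs G `` A \<inter> B \<noteq> {}"
    and linked: "k_linked (parcs G) (pverts G - A - B) t (parcs G `` A) (parcs G `` B)"
  shows "is_minor (K2_star t) G"
proof -
  let ?E = "parcs G"
  obtain d where d: "linked ?E (pverts G - A - B) (?E `` A) (?E `` B) {..<t} d"
    using linked by (rule k_linked_lessThan)
  define D where "D = case_nat A (case_nat B d)"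
  have D: "D 0 = A" "D (Suc 0) = B" "D (Suc (Suc i)) = d i" for i
    by (simp_all add: D_def)
  have comm: "?E `` U \<inter> W \<noteq> {} \<longleftrightarrow> ?E `` W \<inter> U \<noteq> {}" for U W
    using G unfolding pair_graph_iff sym_def by blast
  have link: "d i \<noteq> {}" "d i \<subseteq> pverts G" "d i \<inter> A = {}" "d i \<inter> B = {}" "connected_in ?E (d i)"
    "?E `` A \<inter> d i \<noteq> {}" "?E `` B \<inter> d i \<noteq> {}" if "i < t" for i
    using linkedD[OF d, of i] that by blast+
  have "A \<noteq> {}" "B \<noteq> {}" using AB(2) by auto
  then have "\<forall>i\<in>pverts (K2_star t). D i \<noteq> {} \<and> D i \<subseteq> pverts G \<and> connected_in ?E (D i)"
    using A B link(1,2,5) by (auto simp: pverts_K2_star D)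
  moreover have "disjoint_family_on D ((\<lambda>i. Suc (Suc i)) ` {..<t})"
    using d by (auto simp: linked_def disjoint_family_on_def D)
  then have "disjoint_family_on D (pverts (K2_star t))"
    using AB(1) link(3,4) by (simp add: pverts_K2_star disjoint_family_on_insert image_iff D) blast
  moreover have "\<forall>(i, j)\<in>parcs (K2_star t). ?E `` D i \<inter> D j \<noteq> {}"
    using AB(2) link(6,7) comm by (auto simp: parcs_K2_star D)
  ultimately have "minor_model (K2_star t) G D" by (simp add: minor_model_def)
  then show ?thesis by (rule minor_model_imp_is_minor[OF pair_graph_K2_star G])
qed

section \<open>Tree decompositions from parent functions\<close>

lemma connected_induceI:
  assumes "I \<noteq> {}" "connected_in (parcs T) I"
  shows "Digraph_Component.connected (with_proj T \<restriction> I)"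
proof -
  let ?R = "(arcs_ends (with_proj T \<restriction> I))\<^sup>s"
  have ends: "Restr (parcs T) I \<subseteq> ?R" by (auto simp: arcs_ends_conv induce_subgraph_def symcl_def)
  have "(u, v) \<in> rtrancl_on I ?R" if "v \<in> reach (parcs T) I {u}" for u v
    using that
  proof induction
    case (step y z)
    have "y \<in> I" using reach_subset step.hyps(1) by (rule subsetD)
    then show ?case using step ends by (intro rtrancl_on_into_rtrancl_on[OF step.IH]) auto
  qed auto
  then show ?thesis using assms unfolding connected_conv connected_in_def by (simp add: subset_iff)
qed

lemma (in wf_digraph) cycle_through_arc:
  assumes "cycle p" "e \<in> set p"
  obtains q where "awalk (head G e) q (head G e)" "distinct (map (head G) q)"
    "set q = set p" "length q = length p"
proof -
  obtain u where u: "awalk u p u" "distinct (tl (awalk_verts u p))"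
    using assms(1) by (auto simp: cycle_def)
  then obtain r s where rs: "p = r @ s" "awalk u r (head G e)" "awalk (head G e) s u"
    using awalk_decomp awalk_verts_arc2[OF u(1) assms(2)] by blast
  have "tl (awalk_verts u p) = map (head G) p"
    using u(1) awalk_verts_conv' by (auto simp: awalk_def)
  then have "distinct (map (head G) (s @ r))" using u(2) rs(1) by auto
  moreover have "awalk (head G e) (s @ r) (head G e)" using rs(3,2) by (rule awalk_appendI)
  ultimately show ?thesis using that[of "s @ r"] rs(1) by auto
qed

definition parent_tree :: "nat \<Rightarrow> (nat \<Rightarrow> nat) \<Rightarrow> nat pair_pre_digraph" where
  "parent_tree n p = \<lparr> pverts = {..<n},
    parcs = {(i, j). i < n \<and> j < n \<and> (0 < i \<and> j = p i \<or> 0 < j \<and> i = p j)} \<rparr>"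

lemma pair_graph_parent_tree:
  assumes "\<And>i. 0 < i \<Longrightarrow> i < n \<Longrightarrow> p i < i"
  shows "pair_graph (parent_tree n p)"
proof -
  have "0 < i \<and> i < n \<and> i = p i" if "(i, i) \<in> parcs (parent_tree n p)" for i
    using that by (auto simp: parent_tree_def)
  then have "irrefl (parcs (parent_tree n p))" using assms by (metis irreflI less_irrefl)
  then show ?thesis by (auto simp: pair_graph_iff parent_tree_def sym_def)
qed

text \<open>
  Both arcs of a cycle at its largest vertex join that vertex to its parent, so a cycle of length at
  least 3 would visit the parent twice.
\<close>

lemma parent_tree_acyclic:
  assumes p: "\<And>i. 0 < i \<Longrightarrow> i < n \<Longrightarrow> p i < i"
    and cycle: "pre_digraph.cycle (with_proj (parent_tree n p)) es" and len: "3 \<le> length es"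
  shows False
proof -
  interpret pair_graph "parent_tree n p" using p by (rule pair_graph_parent_tree)
  obtain e where e: "e \<in> set es" "\<And>e'. e' \<in> set es \<Longrightarrow> snd e' \<le> snd e"
    using len Max_in[of "snd ` set es"] Max_ge[of "snd ` set es"] by fastforce
  define M where "M = snd e"
  obtain q where q: "awalk M q M" "distinct (map snd q)" "set q = set es" "length q = length es"
    using cycle_through_arc[OF cycle e(1)] unfolding M_def by auto
  then have "3 \<le> length q" using len by simp
  then obtain a b r where ab: "q = a # r @ [b]" "1 \<le> length r"
    by (cases q; cases "tl q" rule: rev_cases) auto
  then have r: "r \<noteq> []" by auto
  have parent: "i = p M" if "(M, i) \<in> parcs (parent_tree n p)" "i \<le> M" for i
    using that p[of i] by (auto simp: parent_tree_def)
  have "awalk M (a # r @ [b]) M" using q(1) ab(1) by simp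
  then have walk: "fst a = M" "fst b = snd (last r)" "snd b = M"
    using r by (auto simp: awalk_Cons_iff awalk_verts_conv simp flip: awalk_verts_with_proj_eq)
  have arc: "x \<in> parcs (parent_tree n p)" "snd x \<le> M" if "x \<in> set q" for x
    using that q(1,3) e(2) by (auto simp: awalk_def M_def)
  have "snd a = p M"
    using parent[of "snd a"] arc[of a] walk(1) ab(1) by (metis list.set_intros(1) prod.collapse)
  moreover have "last r \<in> set q" "b \<in> set q" using r ab(1) by auto
  then have "snd (last r) = p M"
    using parent[of "fst b"] arc(1)[of b] arc(2)[of "last r"] walk(2,3) arcs_symmetric
    by (metis prod.collapse)
  ultimately show False using q(2) ab(1) last_in_set[OF r] by force
qed

lemma parent_tree_connected_in:
  assumes p: "\<And>i. 0 < i \<Longrightarrow> i < n \<Longrightarrow> p i < i" and "r \<in> I" "I \<subseteq> {..<n}"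
    and I: "\<And>i. i \<in> I \<Longrightarrow> i \<noteq> r \<Longrightarrow> 0 < i \<and> p i \<in> I"
  shows "connected_in (parcs (parent_tree n p)) I"
proof (rule connected_in_extend)
  show "sym (parcs (parent_tree n p))" by (auto simp: parent_tree_def sym_def)
  have "v \<in> reach (parcs (parent_tree n p)) I {r}" if "v \<in> I" for v
    using that
  proof (induction v rule: less_induct)
    case (less v)
    show ?case
    proof (cases "v = r")
      case True
      then show ?thesis using less.prems by (auto intro: reach.base)
    next
      case False
      then have v: "0 < v" "p v \<in> I" "v < n" using less.prems I assms(3) by auto
      then have "p v < v" using p by blast
      have "p v \<in> reach (parcs (parent_tree n p)) I {r}" using \<open>p v < v\<close> v(2) by (rule less.IH)
      moreover have "(p v, v) \<in> parcs (parent_tree n p)"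
        using v \<open>p v < v\<close> by (auto simp: parent_tree_def)
      ultimately show ?thesis using less.prems by (rule reach.step)
    qed
  qed
  then show "I \<subseteq> reach (parcs (parent_tree n p)) I {r}" by blast
qed (use assms(2) in auto)

lemma undirected_tree_parent_tree:
  assumes "0 < n" and p: "\<And>i. 0 < i \<Longrightarrow> i < n \<Longrightarrow> p i < i"
  shows "undirected_tree (parent_tree n p)"
proof -
  have "connected_in (parcs (parent_tree n p)) {..<n}"
    by (rule parent_tree_connected_in[of n p 0]) (use assms p in \<open>auto intro: less_trans\<close>)
  then have "Digraph_Component.connected (with_proj (parent_tree n p) \<restriction> {..<n})"
    using assms(1) by (intro connected_induceI) auto
  moreover have "with_proj (parent_tree n p) \<restriction> {..<n} = with_proj (parent_tree n p)"
    by (auto simp: induce_subgraph_def with_proj_def parent_tree_def)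
  ultimately show ?thesis
    using pair_graph_parent_tree[of n p] parent_tree_acyclic[of n p] p
    unfolding undirected_tree_def by (metis (full_types))
qed

lemma decomposition_width_ge:
  assumes "tree_decomposition G T B" shows "- 1 \<le> decomposition_width T B"
proof -
  have fin: "finite (pverts T)" and "pverts T \<noteq> {}"
    using assms unfolding tree_decomposition_def undirected_tree_def pair_graph_iff connected_conv
      with_proj_simps by blast+
  then obtain i where "i \<in> pverts T" by blast
  then have "int (card (B i)) \<le> Max ((\<lambda>i. int (card (B i))) ` pverts T)"
    using fin by (intro Max_ge) auto
  then show ?thesis unfolding decomposition_width_def by linarith
qed

lemma treewidth_le:
  fixes T :: "nat pair_pre_digraph"
  assumes "tree_decomposition G T B"
  shows "treewidth G \<le> decomposition_width T B"
  unfolding treewidth_def using assms decomposition_width_ge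
  by (intro cInf_lower bdd_belowI[where m = "- 1"]) auto

definition bag_tree :: "nat \<Rightarrow> nat \<Rightarrow> (nat \<Rightarrow> nat) \<Rightarrow> (nat \<Rightarrow> nat set) \<Rightarrow> bool" where
  "bag_tree w n p \<beta> \<longleftrightarrow> 0 < n \<and>
    (\<forall>i<n. i \<in> \<beta> i \<and> \<beta> i \<subseteq> {..i} \<and> card (\<beta> i) \<le> w + 1) \<and>
    (\<forall>i<n. 0 < i \<longrightarrow> p i < i \<and> \<beta> i - {i} \<subseteq> \<beta> (p i))"

lemma bag_tree_extend:
  assumes "bag_tree w n p \<beta>" "i < n" "S \<subseteq> \<beta> i" "card S \<le> w"
  shows "bag_tree w (Suc n) (p(n := i)) (\<beta>(n := insert n S))"
proof -
  have b: "\<beta> i \<subseteq> {..i}" using assms(1,2) by (auto simp: bag_tree_def)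
  then have "finite S" using assms(3) by (meson finite_atMost finite_subset)
  then have "card (insert n S) \<le> w + 1" using assms(4) by (simp add: card_insert_if)
  moreover have "S \<subseteq> {..n}" using assms(2,3) b by fastforce
  moreover have "insert n S - {n} \<subseteq> \<beta> i" using assms(3) by blast
  ultimately show ?thesis
    using assms(1,2) unfolding bag_tree_def by (auto simp: less_Suc_eq)
qed

definition bag_graph :: "nat \<Rightarrow> (nat \<Rightarrow> nat set) \<Rightarrow> nat pair_pre_digraph" where
  "bag_graph n \<beta> = \<lparr> pverts = {..<n},
    parcs = {(u, v). u < n \<and> v < n \<and> u \<noteq> v \<and> (\<exists>i<n. u \<in> \<beta> i \<and> v \<in> \<beta> i)} \<rparr>"

lemma pair_graph_bag_graph: "pair_graph (bag_graph n \<beta>)"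
  by (auto simp: pair_graph_iff bag_graph_def sym_def irrefl_def)

lemma treewidth_bag_graph:
  assumes "bag_tree w n p \<beta>"
  shows "treewidth (bag_graph n \<beta>) \<le> int w"
proof -
  let ?T = "parent_tree n p"
  have n: "0 < n" and b: "\<And>i. i < n \<Longrightarrow> i \<in> \<beta> i" "\<And>i. i < n \<Longrightarrow> \<beta> i \<subseteq> {..i}"
    "\<And>i. i < n \<Longrightarrow> card (\<beta> i) \<le> w + 1"
    and p: "\<And>i. 0 < i \<Longrightarrow> i < n \<Longrightarrow> p i < i" "\<And>i. 0 < i \<Longrightarrow> i < n \<Longrightarrow> \<beta> i - {i} \<subseteq> \<beta> (p i)"
    using assms by (auto simp: bag_tree_def)
  have verts: "pverts ?T = {..<n}" by (simp add: parent_tree_def)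
  have conn: "Digraph_Component.connected (with_proj ?T \<restriction> {i \<in> pverts ?T. v \<in> \<beta> i})"
    if v: "v < n" for v
  proof (intro connected_induceI parent_tree_connected_in[where r = v])
    fix i assume i: "i \<in> {i \<in> pverts ?T. v \<in> \<beta> i}" "i \<noteq> v"
    then have "v < i" using b(2)[of i] verts by force
    then have "0 < i" "i < n" using i verts by auto
    then show "0 < i \<and> p i \<in> {i \<in> pverts ?T. v \<in> \<beta> i}"
      using p[of i] i verts by auto
  qed (use v b p verts in auto)
  have "tree_decomposition (bag_graph n \<beta>) ?T \<beta>"
    unfolding tree_decomposition_def
  proof (intro conjI)
    show "undirected_tree ?T" using undirected_tree_parent_tree[OF n p(1)] by blast
    show "\<forall>i\<in>pverts ?T. \<beta> i \<subseteq> pverts (bag_graph n \<beta>)"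
      using b(2) by (fastforce simp: verts bag_graph_def)
  qed (use conn in \<open>auto simp: verts bag_graph_def\<close>)
  then have "treewidth (bag_graph n \<beta>) \<le> decomposition_width ?T \<beta>" by (rule treewidth_le)
  moreover have "Max ((\<lambda>i. int (card (\<beta> i))) ` pverts ?T) \<le> int (w + 1)"
    using n b(3) unfolding verts by (intro Max.boundedI) force+
  then have "decomposition_width ?T \<beta> \<le> int w" by (simp add: decomposition_width_def)
  ultimately show ?thesis by linarith
qed

section \<open>Splitting a guarded component\<close>

text \<open>
  \<open>A\<close> and \<open>B\<close> are the prospective branch sets of the two hubs of a $K^{\ast}_{2,t}$ minor whose
  other branch sets lie in \<open>C\<close>; either of them may be empty.
\<close>

definition guards :: "'a pair_pre_digraph \<Rightarrow> 'a set \<Rightarrow> 'a set \<Rightarrow> 'a set \<Rightarrow> bool" where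
  "guards G C A B \<longleftrightarrow>
    A \<subseteq> pverts G - C \<and> B \<subseteq> pverts G - C \<and> A \<inter> B = {} \<and>
    connected_in (parcs G) A \<and> connected_in (parcs G) B \<and>
    (A \<noteq> {} \<longrightarrow> B \<noteq> {} \<longrightarrow> parcs G `` A \<inter> B \<noteq> {}) \<and>
    nbhd (parcs G) C \<subseteq> A \<union> B"

lemma guards_commute: "pair_graph G \<Longrightarrow> guards G C A B \<longleftrightarrow> guards G C B A"
  unfolding guards_def pair_graph_iff sym_def by blast

lemma guards_image_nbhd:
  assumes "guards G C A B" "q ` (nbhd (parcs G) C \<inter> A) \<subseteq> {a}" "q ` (nbhd (parcs G) C \<inter> B) \<subseteq> {b}"
  shows "q ` nbhd (parcs G) C \<subseteq> {a, b}"
proof -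
  have "nbhd (parcs G) C \<subseteq> A \<union> B" using assms(1) by (simp add: guards_def)
  then show ?thesis using assms(2,3) by blast
qed

definition splits_guards ::
  "'a pair_pre_digraph \<Rightarrow> 'a set \<Rightarrow> 'a set \<Rightarrow> 'a set \<Rightarrow> 'a set \<Rightarrow> bool" where
  "splits_guards G C A B P \<longleftrightarrow> (\<forall>C'. component (parcs G) (C - P) C' \<longrightarrow>
    (\<exists>A' B'. guards G C' A' B' \<and> nbhd (parcs G) C' \<inter> B' \<subseteq> P \<and>
      (nbhd (parcs G) C' \<inter> A' \<subseteq> A \<or> nbhd (parcs G) C' \<inter> A' \<subseteq> B)))"

lemma splits_guards_commute: "splits_guards G C A B P \<longleftrightarrow> splits_guards G C B A P"
  unfolding splits_guards_def by (simp add: disj_commute)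

lemma splits_guards_vertex:
  assumes G: "pair_graph G" and g: "guards G C A B" and C: "C \<subseteq> pverts G" "C \<noteq> {}"
    and nB: "nbhd (parcs G) C \<inter> B = {}"
  obtains v where "v \<in> C" "splits_guards G C A B {v}"
proof -
  let ?E = "parcs G"
  define A' where "A' = (if nbhd ?E C \<inter> A = {} then {} else A)"
  have A': "A' \<subseteq> A" "nbhd ?E C \<subseteq> A'" "connected_in ?E A'"
    using g nB by (auto simp: A'_def guards_def)
  obtain v where v: "v \<in> C" "A' \<noteq> {} \<longrightarrow> v \<in> ?E `` A'"
  proof (cases "nbhd ?E C \<inter> A = {}")
    case True
    then show ?thesis using that C(2) by (auto simp: A'_def)
  next
    case False
    then obtain a v where "a \<in> A" "v \<in> C" "(v, a) \<in> ?E" by (auto simp: nbhd_def)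
    moreover have "sym ?E" using G by (simp add: pair_graph_iff)
    ultimately show ?thesis using that[of v] False by (auto simp: A'_def dest: symD)
  qed
  have "guards G C' A' {v}" if C': "component ?E (C - {v}) C'" for C'
  proof -
    have "C' \<subseteq> C - {v}" "nbhd ?E C' \<subseteq> A' \<union> {v}"
      using C' nbhd_component_Diff[OF C'] A'(2) by (auto simp: component_def)
    then show ?thesis using g A' v C(1) by (auto simp: guards_def)
  qed
  then have "splits_guards G C A B {v}"
    using A'(1) unfolding splits_guards_def by blast
  then show ?thesis using that v(1) by blast
qed

lemma guards_absorb_separator:
  fixes G A B C P
  defines "B' \<equiv> B \<union> P \<union> reach (parcs G) (C - P) (parcs G `` B)"
  assumes G: "pair_graph G" and g: "guards G C A B" and C: "C \<subseteq> pverts G" and ne: "A \<noteq> {}" "B \<noteq> {}"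
    and P: "minimal_separator (parcs G) C P (parcs G `` A) (parcs G `` B)"
    and C': "component (parcs G) (C - P) C'" "C' \<inter> parcs G `` B = {}"
  shows "guards G C' A B'" "nbhd (parcs G) C' \<inter> B' \<subseteq> P"
proof -
  let ?E = "parcs G"
  let ?S = "reach ?E (C - P) (?E `` B)"
  have E: "sym ?E" using G by (simp add: pair_graph_iff)
  have old: "A \<subseteq> pverts G - C" "B \<subseteq> pverts G - C" "A \<inter> B = {}" "connected_in ?E A"
    "connected_in ?E B" "?E `` A \<inter> B \<noteq> {}" "nbhd ?E C \<subseteq> A \<union> B"
    using g ne unfolding guards_def by blast+
  have C'_props: "C' \<subseteq> C - P" "nbhd ?E C' \<inter> (C - P) = {}" "nbhd ?E C' \<subseteq> nbhd ?E C \<union> P"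
    using C'(1) nbhd_component_Diff[OF C'(1)] by (auto simp: component_def)
  have PC: "P \<subseteq> C" using P by (simp add: minimal_separator_def)
  have S: "?S \<subseteq> C - P" by (rule reach_subset)
  have "P \<subseteq> ?E `` (B \<union> ?S)" using minimal_separator_adjacent[OF E P] by blast
  then have conn: "connected_in ?E B'"
    unfolding B'_def by (rule connected_in_Un_reach[OF E old(5)])
  have "C' \<inter> ?S = {}" using C' by (rule component_disjoint_reach[OF E])
  then have "B' \<subseteq> pverts G - C'" using old(2) C C'_props(1) PC S by (auto simp: B'_def)
  moreover have "A \<inter> B' = {}" using old(1,3) PC S by (auto simp: B'_def)
  moreover have "?E `` A \<inter> B' \<noteq> {}" "nbhd ?E C' \<subseteq> A \<union> B'" "A \<subseteq> pverts G - C'"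
    using old(1,6,7) C'_props(1,3) by (auto simp: B'_def)
  ultimately show "guards G C' A B'" using old(4) conn by (simp add: guards_def)
  have "B \<inter> C' = {}" using old(2) C'_props(1) by blast
  then have "nbhd ?E C' \<inter> B = {}" using nbhd_disjoint_iff[OF E] C'(2) by blast
  then show "nbhd ?E C' \<inter> B' \<subseteq> P" using C'_props(2) S by (auto simp: B'_def)
qed

lemma splits_guards_minimal_separator:
  assumes G: "pair_graph G" and g: "guards G C A B" and C: "C \<subseteq> pverts G" and ne: "A \<noteq> {}" "B \<noteq> {}"
    and P: "minimal_separator (parcs G) C P (parcs G `` A) (parcs G `` B)"
  shows "splits_guards G C A B P"
  unfolding splits_guards_def
proof (intro allI impI)
  let ?E = "parcs G"
  have E: "sym ?E" using G by (simp add: pair_graph_iff)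
  fix C' assume C': "component ?E (C - P) C'"
  have "C' \<inter> ?E `` A = {} \<or> C' \<inter> ?E `` B = {}"
  proof (rule ccontr)
    assume "\<not> ?thesis"
    moreover have "separates ?E C' {} (?E `` A) (?E `` B)"
      using P C' reach_mono[of ?E ?E C' "C - P" "?E `` A" "?E `` A"]
      by (auto simp: minimal_separator_def separates_def component_def)
    ultimately show False using separator_nonempty C' unfolding component_def by metis
  qed
  then show "\<exists>A' B'. guards G C' A' B' \<and> nbhd ?E C' \<inter> B' \<subseteq> P \<and>
      (nbhd ?E C' \<inter> A' \<subseteq> A \<or> nbhd ?E C' \<inter> A' \<subseteq> B)"
  proof
    assume "C' \<inter> ?E `` B = {}"
    from guards_absorb_separator[OF G g C ne P C' this] show ?thesis by blast
  next
    have "guards G C B A" "minimal_separator ?E C P (?E `` B) (?E `` A)"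
      using g P guards_commute[OF G] minimal_separator_commute[OF E] by blast+
    moreover assume "C' \<inter> ?E `` A = {}"
    ultimately show ?thesis using guards_absorb_separator[OF G _ C ne(2,1) _ C'] by blast
  qed
qed

lemma guards_not_k_linked:
  assumes "pair_graph G" "minor_free (K2_star t) G" and g: "guards G C A B"
    and "C \<subseteq> pverts G" "A \<noteq> {}" "B \<noteq> {}"
  shows "\<not> k_linked (parcs G) C t (parcs G `` A) (parcs G `` B)"
proof
  assume "k_linked (parcs G) C t (parcs G `` A) (parcs G `` B)"
  moreover have "C \<subseteq> pverts G - A - B" using g assms(4) by (auto simp: guards_def)
  ultimately have "k_linked (parcs G) (pverts G - A - B) t (parcs G `` A) (parcs G `` B)"
    unfolding k_linked_def using linked_mono[OF _ order_refl] by metis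
  then have "is_minor (K2_star t) G"
    using g assms(5,6) by (intro is_minor_K2_starI[OF assms(1), of A B]) (auto simp: guards_def)
  then show False using assms(2) by blast
qed

lemma splits_guards_exists:
  assumes "2 \<le> t" and G: "pair_graph G" and free: "minor_free (K2_star t) G"
    and g: "guards G C A B" and C: "C \<subseteq> pverts G" "C \<noteq> {}" "connected_in (parcs G) C"
  obtains P where "P \<subseteq> C" "P \<noteq> {}" "card P \<le> t - 1" "splits_guards G C A B P"
proof -
  let ?E = "parcs G"
  consider "nbhd ?E C \<inter> B = {}" | "nbhd ?E C \<inter> A = {}" |
    "nbhd ?E C \<inter> A \<noteq> {}" "nbhd ?E C \<inter> B \<noteq> {}" by blast
  then show ?thesis
  proof cases
    case 1
    obtain v where "v \<in> C" "splits_guards G C A B {v}"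
      using splits_guards_vertex[OF G g C(1,2) 1] by blast
    then show ?thesis using that[of "{v}"] assms(1) by auto
  next
    case 2
    have "guards G C B A" using g guards_commute[OF G] by blast
    from splits_guards_vertex[OF G this C(1,2) 2] obtain v
      where "v \<in> C" "splits_guards G C B A {v}" .
    then show ?thesis using that[of "{v}"] assms(1) splits_guards_commute[of G C A B] by auto
  next
    case 3
    then have ne: "A \<noteq> {}" "B \<noteq> {}" by auto
    have E: "sym ?E" "finite C" using G C(1) finite_subset by (auto simp: pair_graph_iff)
    then have "\<not> connectivity_at_least ?E C t (?E `` A) (?E `` B)"
      using menger guards_not_k_linked[OF G free g C(1) ne] by blast
    then obtain P where P: "minimal_separator ?E C P (?E `` A) (?E `` B)" "card P < t"
      using minimal_separator_exists[OF E(2)] by blast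
    have "A \<inter> C = {}" "B \<inter> C = {}" using g by (auto simp: guards_def)
    then have "C \<inter> ?E `` A \<noteq> {}" "C \<inter> ?E `` B \<noteq> {}"
      using 3 nbhd_disjoint_iff[OF E(1)] by simp_all
    then have "P \<noteq> {}"
      using separator_nonempty[OF _ C(3)] P(1) unfolding minimal_separator_def by blast
    moreover have "P \<subseteq> C" using P(1) by (simp add: minimal_separator_def)
    ultimately show ?thesis
      using that splits_guards_minimal_separator[OF G g C(1) ne P(1)] P(2) by simp
  qed
qed

section \<open>Subgraphs of strong products\<close>

lemma pair_graph_complete_graph: "pair_graph (complete_graph n)"
proof -
  have "parcs (complete_graph n) \<subseteq> {..<n} \<times> {..<n}" by (auto simp: complete_graph_def)
  then show ?thesis by (auto simp: pair_graph_iff complete_graph_def sym_def irrefl_def)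
qed

lemma pair_graph_strong_product:
  assumes "pair_graph A" "pair_graph B"
  shows "pair_graph (strong_product A B)"
proof -
  have "sym (parcs A)" "sym (parcs B)" using assms by (auto simp: pair_graph_iff)
  then have "sym (parcs (strong_product A B))" by (auto simp: strong_product_def sym_def)
  then show ?thesis using assms
    by (auto simp: pair_graph_iff strong_product_def irrefl_def)
qed

lemma iso_to_subgraphI:
  assumes "pair_graph G" "pair_graph J" "inj_on f (pverts G)" "f ` pverts G \<subseteq> pverts J"
    "\<And>x y. (x, y) \<in> parcs G \<Longrightarrow> f x \<noteq> f y \<Longrightarrow> (f x, f y) \<in> parcs J"
  shows "iso_to_subgraph G J"
proof -
  have "pair_graph (graph_image f G)" using assms(1) by (rule pair_graph_image)
  moreover from this have "subgraph (with_proj (graph_image f G)) (with_proj J)"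
    using assms by (intro subgraph_with_projI) (auto simp: parcs_graph_image)
  ultimately show ?thesis unfolding iso_to_subgraph_def
    using digraph_iso_graph_image[OF assms(1,3)] by blast
qed

lemma iso_to_subgraph_strong_product_complete:
  assumes G: "pair_graph G" and H: "pair_graph H"
    and q: "\<And>x. x \<in> pverts G \<Longrightarrow> q x \<in> pverts H"
    and fib: "\<And>j. card {x \<in> pverts G. q x = j} \<le> m"
    and edge: "\<And>x y. (x, y) \<in> parcs G \<Longrightarrow> q x = q y \<or> (q x, q y) \<in> parcs H"
  shows "iso_to_subgraph G (strong_product H (complete_graph m))"
proof -
  have "\<exists>f. f ` {x \<in> pverts G. q x = j} \<subseteq> {..<m} \<and> inj_on f {x \<in> pverts G. q x = j}" for j
    using card_le_inj[of "{x \<in> pverts G. q x = j}" "{..<m}"] fib G by (auto simp: pair_graph_iff)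
  then obtain f where f: "\<And>j. f j ` {x \<in> pverts G. q x = j} \<subseteq> {..<m}"
    "\<And>j. inj_on (f j) {x \<in> pverts G. q x = j}" by metis
  let ?h = "\<lambda>x. (q x, f (q x) x)"
  have lt: "f (q x) x < m" if "x \<in> pverts G" for x using f(1)[of "q x"] that by auto
  show ?thesis
  proof (rule iso_to_subgraphI[where f = ?h, OF G])
    show "pair_graph (strong_product H (complete_graph m))"
      by (intro pair_graph_strong_product H pair_graph_complete_graph)
    show "inj_on ?h (pverts G)"
    proof (rule inj_onI)
      fix x y assume "x \<in> pverts G" "y \<in> pverts G" "?h x = ?h y"
      then show "x = y" using inj_onD[OF f(2)[of "q y"], of x y] by auto
    qed
    show "?h ` pverts G \<subseteq> pverts (strong_product H (complete_graph m))"
      using q lt by (auto simp: strong_product_def complete_graph_def)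
  next
    fix x y assume xy: "(x, y) \<in> parcs G" "?h x \<noteq> ?h y"
    then have V: "x \<in> pverts G" "y \<in> pverts G" using G by (auto simp: pair_graph_iff)
    have "(u, v) \<in> parcs (complete_graph m)" if "u < m" "v < m" "u \<noteq> v" for u v
      using that by (simp add: complete_graph_def)
    then show "(?h x, ?h y) \<in> parcs (strong_product H (complete_graph m))"
      using xy(2) edge[OF xy(1)] q[OF V(1)] q[OF V(2)] lt[OF V(1)] lt[OF V(2)]
      by (auto simp: strong_product_def complete_graph_def)
  qed
qed

section \<open>Building the partition\<close>

definition bag_partition ::
  "'a pair_pre_digraph \<Rightarrow> 'a set \<Rightarrow> nat \<Rightarrow> nat \<Rightarrow> (nat \<Rightarrow> nat set) \<Rightarrow> ('a \<Rightarrow> nat) \<Rightarrow> bool" where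
  "bag_partition G U m n \<beta> q \<longleftrightarrow>
    (\<forall>x\<in>U. q x < n) \<and> (\<forall>j. card {x \<in> U. q x = j} \<le> m) \<and>
    (\<forall>x\<in>U. \<forall>y\<in>U. (x, y) \<in> parcs G \<longrightarrow> (\<exists>i<n. q x \<in> \<beta> i \<and> q y \<in> \<beta> i))"

lemma bag_partition_extend:
  assumes G: "pair_graph G" and part: "bag_partition G U m n \<beta> q"
    and P: "finite P" "card P \<le> m" "P \<inter> U = {}" and S: "q ` (nbhd (parcs G) P \<inter> U) \<subseteq> S"
  shows "bag_partition G (U \<union> P) m (Suc n) (\<beta>(n := insert n S)) (override_on q (\<lambda>_. n) P)"
    (is "bag_partition _ _ _ _ ?\<beta> ?q")
proof -
  have q: "?q x = q x" "q x < n" if "x \<in> U" for x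
    using that part P(3) by (auto simp: override_on_def bag_partition_def)
  have qP: "?q x = n" if "x \<in> P" for x using that by simp
  have fibre: "card {x \<in> U \<union> P. ?q x = j} \<le> m" for j
  proof (cases "j = n")
    case True
    then have "{x \<in> U \<union> P. ?q x = j} \<subseteq> P" using q by fastforce
    then show ?thesis using card_mono[OF P(1)] P(2) by (meson le_trans)
  next
    case False
    then have "{x \<in> U \<union> P. ?q x = j} = {x \<in> U. q x = j}" using q qP by auto
    then show ?thesis using part by (simp add: bag_partition_def)
  qed
  have new: "?q y \<in> ?\<beta> n" if "x \<in> P" "y \<in> U \<union> P" "(x, y) \<in> parcs G" for x y
    using that S P(3) by (cases "y \<in> P") (auto simp: override_on_def nbhd_def)
  have "\<exists>i<Suc n. ?q x \<in> ?\<beta> i \<and> ?q y \<in> ?\<beta> i"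
    if xy: "x \<in> U \<union> P" "y \<in> U \<union> P" "(x, y) \<in> parcs G" for x y
  proof -
    have yx: "(y, x) \<in> parcs G" using G xy(3) by (auto simp: pair_graph_iff dest: symD)
    consider "x \<in> P" | "y \<in> P" | "x \<in> U" "y \<in> U" using xy by blast
    then show ?thesis
    proof cases
      case 1
      then show ?thesis using new[OF _ xy(2,3)] qP by (intro exI[of _ n]) simp
    next
      case 2
      then show ?thesis using new[OF _ xy(1) yx] qP by (intro exI[of _ n]) simp
    next
      case 3
      then obtain i where "i < n" "q x \<in> \<beta> i" "q y \<in> \<beta> i"
        using part xy(3) unfolding bag_partition_def by blast
      then show ?thesis using 3 q by (intro exI[of _ i]) simp
    qed
  qed
  then show ?thesis using fibre q qP unfolding bag_partition_def by (auto simp: less_Suc_eq)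
qed

definition bag_guarded ::
  "'a pair_pre_digraph \<Rightarrow> nat \<Rightarrow> (nat \<Rightarrow> nat set) \<Rightarrow> ('a \<Rightarrow> nat) \<Rightarrow> 'a set \<Rightarrow> bool" where
  "bag_guarded G n \<beta> q C \<longleftrightarrow> (\<exists>A B. guards G C A B \<and> (\<exists>i<n. \<exists>a\<in>\<beta> i. \<exists>b\<in>\<beta> i.
    q ` (nbhd (parcs G) C \<inter> A) \<subseteq> {a} \<and> q ` (nbhd (parcs G) C \<inter> B) \<subseteq> {b}))"

lemma bag_guardedE:
  assumes "bag_guarded G n \<beta> q C"
  obtains A B i a b where "guards G C A B" "i < n" "a \<in> \<beta> i" "b \<in> \<beta> i"
    "q ` (nbhd (parcs G) C \<inter> A) \<subseteq> {a}" "q ` (nbhd (parcs G) C \<inter> B) \<subseteq> {b}"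
  using assms unfolding bag_guarded_def by (elim exE bexE conjE) (rule that)

lemma bag_guarded_extend:
  assumes "bag_guarded G n \<beta> q C" "nbhd (parcs G) C \<inter> P = {}"
  shows "bag_guarded G (Suc n) (\<beta>(n := S)) (override_on q (\<lambda>_. n) P) C"
proof -
  have "override_on q (\<lambda>_. n) P ` (nbhd (parcs G) C \<inter> Z) = q ` (nbhd (parcs G) C \<inter> Z)" for Z
    using assms(2) by (intro image_cong) (auto simp: override_on_def)
  moreover obtain A B i a b where "guards G C A B" and i: "i < n" "a \<in> \<beta> i" "b \<in> \<beta> i"
    and "q ` (nbhd (parcs G) C \<inter> A) \<subseteq> {a}" "q ` (nbhd (parcs G) C \<inter> B) \<subseteq> {b}"
    using assms(1) by (rule bag_guardedE)
  moreover from i have "i < Suc n" "a \<in> (\<beta>(n := S)) i" "b \<in> (\<beta>(n := S)) i" by auto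
  ultimately show ?thesis unfolding bag_guarded_def by metis
qed

lemma bag_guarded_split:
  assumes g: "guards G C A B" and split: "splits_guards G C A B P" and PC: "P \<subseteq> C"
    and q: "q ` (nbhd (parcs G) C \<inter> A) \<subseteq> {a}" "q ` (nbhd (parcs G) C \<inter> B) \<subseteq> {b}"
    and C': "component (parcs G) (C - P) C'"
  shows "bag_guarded G (Suc n) (\<beta>(n := insert n {a, b})) (override_on q (\<lambda>_. n) P) C'"
proof -
  let ?q = "override_on q (\<lambda>_. n) P"
  obtain A' B' where new: "guards G C' A' B'" "nbhd (parcs G) C' \<inter> B' \<subseteq> P"
    "nbhd (parcs G) C' \<inter> A' \<subseteq> A \<or> nbhd (parcs G) C' \<inter> A' \<subseteq> B"
    using split C' unfolding splits_guards_def by blast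
  have old: "?q ` (nbhd (parcs G) C' \<inter> A') \<subseteq> {c}"
    if c: "nbhd (parcs G) C' \<inter> A' \<subseteq> Z" "Z \<inter> C = {}" "q ` (nbhd (parcs G) C \<inter> Z) \<subseteq> {c}" for Z c
    using c nbhd_component_Diff[OF C'] PC by (fastforce simp: override_on_def)
  have "A \<inter> C = {}" "B \<inter> C = {}" using g by (auto simp: guards_def)
  then obtain c where c: "c \<in> {a, b}" "?q ` (nbhd (parcs G) C' \<inter> A') \<subseteq> {c}"
    using new(3) old q by blast
  have "?q ` (nbhd (parcs G) C' \<inter> B') \<subseteq> {n}" using new(2) by auto
  moreover have "c \<in> (\<beta>(n := insert n {a, b})) n" "n \<in> (\<beta>(n := insert n {a, b})) n"
    using c(1) by auto
  ultimately show ?thesis using new(1) c(2) lessI[of n] unfolding bag_guarded_def by metis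
qed

lemma bag_partition_split:
  assumes G: "pair_graph G" and part: "bag_partition G (pverts G - R) m n \<beta> q"
    and g: "guards G C A B" and "P \<subseteq> C" "C \<subseteq> R" "R \<subseteq> pverts G" "card P \<le> m"
    and q: "q ` (nbhd (parcs G) C \<inter> A) \<subseteq> {a}" "q ` (nbhd (parcs G) C \<inter> B) \<subseteq> {b}"
  shows "bag_partition G (pverts G - (R - P)) m (Suc n)
    (\<beta>(n := insert n {a, b})) (override_on q (\<lambda>_. n) P)"
proof -
  have "nbhd (parcs G) P \<inter> (pverts G - R) \<subseteq> nbhd (parcs G) C"
    using assms(4,5) by (auto simp: nbhd_def)
  then have "q ` (nbhd (parcs G) P \<inter> (pverts G - R)) \<subseteq> {a, b}"
    using guards_image_nbhd[OF g q] by blast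
  moreover have PR: "P \<subseteq> R" using assms(4,5) by (rule subset_trans)
  then have "finite P"
    using G assms(6) by (meson finite_subset pair_graph_iff subset_trans)
  moreover have "P \<inter> (pverts G - R) = {}" using PR by blast
  ultimately have "bag_partition G (pverts G - R \<union> P) m (Suc n)
      (\<beta>(n := insert n {a, b})) (override_on q (\<lambda>_. n) P)"
    using assms(7) by (intro bag_partition_extend[OF G part])
  moreover have "pverts G - (R - P) = pverts G - R \<union> P" using PR assms(6) by blast
  ultimately show ?thesis by simp
qed

text \<open>\<open>R\<close> is the set of vertices that are not yet assigned to a part, and \<open>q\<close> is irrelevant on \<open>R\<close>.\<close>

definition partial_layout :: "'a pair_pre_digraph \<Rightarrow> nat \<Rightarrow> 'a set \<Rightarrow> nat \<Rightarrow> (nat \<Rightarrow> nat) \<Rightarrow>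
    (nat \<Rightarrow> nat set) \<Rightarrow> ('a \<Rightarrow> nat) \<Rightarrow> bool" where
  "partial_layout G m R n p \<beta> q \<longleftrightarrow> R \<subseteq> pverts G \<and> bag_tree 2 n p \<beta> \<and>
    bag_partition G (pverts G - R) m n \<beta> q \<and>
    (\<forall>C. component (parcs G) R C \<longrightarrow> bag_guarded G n \<beta> q C)"

text \<open>Part 0 is left empty, so that the decomposition tree is nonempty even if \<open>G\<close> has no vertices.\<close>

lemma partial_layout_init:
  assumes "pair_graph G"
  shows "partial_layout G m (pverts G) 1 id (\<lambda>_. {0}) q"
proof -
  have "bag_guarded G 1 (\<lambda>_. {0}) q C" if "component (parcs G) (pverts G) C" for C
  proof -
    have "nbhd (parcs G) C = {}"
      using that assms unfolding component_def nbhd_def pair_graph_iff by blast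
    then have "guards G C {} {}" by (simp add: guards_def)
    then show ?thesis
      using \<open>nbhd (parcs G) C = {}\<close> unfolding bag_guarded_def by (intro exI[of _ "{}"]) auto
  qed
  then show ?thesis unfolding partial_layout_def bag_tree_def bag_partition_def by auto
qed

lemma partial_layout_step:
  assumes t: "2 \<le> t" and G: "pair_graph G" and free: "minor_free (K2_star t) G"
    and layout: "partial_layout G (t - 1) R n p \<beta> q" and R: "R \<noteq> {}"
  obtains R' n' p' \<beta>' q' where "R' \<subset> R" "partial_layout G (t - 1) R' n' p' \<beta>' q'"
proof -
  let ?E = "parcs G"
  have E: "sym ?E" using G by (simp add: pair_graph_iff)
  have RV: "R \<subseteq> pverts G" and tree: "bag_tree 2 n p \<beta>"
    and part: "bag_partition G (pverts G - R) (t - 1) n \<beta> q"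
    and comp: "\<And>C. component ?E R C \<Longrightarrow> bag_guarded G n \<beta> q C"
    using layout unfolding partial_layout_def by blast+
  obtain C where C: "component ?E R C" using R component_reach[OF E] by blast
  then have CR: "C \<subseteq> R" "C \<noteq> {}" "connected_in ?E C" by (simp_all add: component_def)
  obtain A B i a b where g: "guards G C A B" and i: "i < n" "a \<in> \<beta> i" "b \<in> \<beta> i"
    and q: "q ` (nbhd ?E C \<inter> A) \<subseteq> {a}" "q ` (nbhd ?E C \<inter> B) \<subseteq> {b}"
    using comp[OF C] by (rule bag_guardedE)
  have "C \<subseteq> pverts G" using CR RV by blast
  from splits_guards_exists[OF t G free g this CR(2,3)] obtain P
    where P: "P \<subseteq> C" "P \<noteq> {}" "card P \<le> t - 1" and split: "splits_guards G C A B P" .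
  have PR: "P \<subseteq> R" using P(1) CR(1) by blast
  let ?\<beta> = "\<beta>(n := insert n {a, b})" and ?q = "override_on q (\<lambda>_. n) P"
  have "bag_tree 2 (Suc n) (p(n := i)) ?\<beta>"
    using tree i by (intro bag_tree_extend) (auto simp: card_insert_if)
  moreover have "bag_partition G (pverts G - (R - P)) (t - 1) (Suc n) ?\<beta> ?q"
    by (rule bag_partition_split[OF G part g P(1) CR(1) RV P(3) q])
  moreover have "bag_guarded G (Suc n) ?\<beta> ?q C'" if C': "component ?E (R - P) C'" for C'
  proof (rule component_Diff_cases[OF E C P(1) C'])
    assume old: "component ?E R C'"
    then have "nbhd ?E C' \<inter> P = {}" using PR by (auto simp: component_def)
    with comp[OF old] show ?thesis by (rule bag_guarded_extend)
  next
    assume "component ?E (C - P) C'"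
    then show ?thesis by (rule bag_guarded_split[OF g split P(1) q])
  qed
  ultimately have "partial_layout G (t - 1) (R - P) (Suc n) (p(n := i)) ?\<beta> ?q"
    using RV unfolding partial_layout_def by blast
  moreover have "R - P \<subset> R" using P(2) PR by blast
  ultimately show ?thesis using that by blast
qed

lemma complete_layout_exists:
  assumes t: "2 \<le> t" and G: "pair_graph G" and free: "minor_free (K2_star t) G"
  obtains n p \<beta> q where "partial_layout G (t - 1) {} n p \<beta> q"
proof -
  have "\<exists>n p \<beta> q. partial_layout G (t - 1) {} n p \<beta> q"
    if "finite R" "partial_layout G (t - 1) R n p \<beta> q" for R n p \<beta> q
    using that
  proof (induction R arbitrary: n p \<beta> q rule: finite_psubset_induct)
    case (psubset R)
    show ?case
    proof (cases "R = {}")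
      case False
      then show ?thesis using partial_layout_step[OF t G free psubset.prems] psubset.IH by metis
    qed (use psubset.prems in blast)
  qed
  moreover have "finite (pverts G)" using G by (simp add: pair_graph_iff)
  ultimately have "\<exists>n p \<beta> q. partial_layout G (t - 1) {} n p \<beta> q"
    using partial_layout_init[OF G] by metis
  then show ?thesis by (elim exE) (rule that)
qed

lemma iso_to_subgraph_bag_partition:
  assumes G: "pair_graph G" and part: "bag_partition G (pverts G) m n \<beta> q"
  shows "iso_to_subgraph G (strong_product (bag_graph n \<beta>) (complete_graph m))"
proof (rule iso_to_subgraph_strong_product_complete[OF G pair_graph_bag_graph])
  fix x y assume xy: "(x, y) \<in> parcs G"
  then have V: "x \<in> pverts G" "y \<in> pverts G" using G by (auto simp: pair_graph_iff)
  then obtain i where "i < n" "q x \<in> \<beta> i" "q y \<in> \<beta> i"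
    using part xy unfolding bag_partition_def by blast
  then show "q x = q y \<or> (q x, q y) \<in> parcs (bag_graph n \<beta>)"
    using part V by (auto simp: bag_partition_def bag_graph_def)
qed (use part in \<open>auto simp: bag_partition_def bag_graph_def\<close>)

theorem theorem24:
  fixes t :: nat and G :: "'a pair_pre_digraph"
  assumes "t \<ge> 2"
    and "pair_graph G"
    and "minor_free (K2_star t) G"
  shows "\<exists>H :: nat pair_pre_digraph. pair_graph H \<and> treewidth H \<le> 2 \<and>
    iso_to_subgraph G (strong_product H (complete_graph (t - 1)))"
proof -
  obtain n p \<beta> q where "partial_layout G (t - 1) {} n p \<beta> q"
    using complete_layout_exists[OF assms] .
  then have tree: "bag_tree 2 n p \<beta>" and part: "bag_partition G (pverts G) (t - 1) n \<beta> q"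
    by (simp_all add: partial_layout_def)
  show ?thesis
  proof (intro exI conjI)
    show "pair_graph (bag_graph n \<beta>)" by (rule pair_graph_bag_graph)
    show "treewidth (bag_graph n \<beta>) \<le> 2" using treewidth_bag_graph[OF tree] by simp
    show "iso_to_subgraph G (strong_product (bag_graph n \<beta>) (complete_graph (t - 1)))"
      using assms(2) part by (rule iso_to_subgraph_bag_partition)
  qed
qed

end
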